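(* Let $H$ be any infinite dimensional Hilbert space. Then there exist a vector $x\in H$, orthogonal projections $Q_1,\dots,Q_5$ in $H$, and a sequence $(P_n)_{n\geq 1}$ with $P_n\in\{Q_1,\dots,Q_5\}$ for every $n\ge 1$, such that the sequence $(P_nP_{n-1}\cdots P_1x)_{n\geq 1}$ diverges in norm, i.e. it does not converge in the norm of $H$.
   Context: An orthogonal projection in $H$ is the bounded linear self-adjoint idempotent operator projecting $H$ onto a closed linear subspace. *)

theory Defs
  imports "HOL-Analysis.Analysis"
begin

text \<open>
  A complex inner product space, given on top of its underlying real inner product space, whose
  inner product is the real part of the complex one. Hence norm, metric and topology are the usual
  ones, and definiteness of the complex inner product follows from that of the real one.
  The complex inner product is conjugate linear in its first argument.
\<close>

class complex_inner = real_inner +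
  fixes scaleC :: "complex \<Rightarrow> 'a \<Rightarrow> 'a" (infixr \<open>*\<^sub>C\<close> 75)
    and cinner :: "'a \<Rightarrow> 'a \<Rightarrow> complex"
  assumes scaleC_add_right: "c *\<^sub>C (x + y) = c *\<^sub>C x + c *\<^sub>C y"
    and scaleC_add_left: "(c + d) *\<^sub>C x = c *\<^sub>C x + d *\<^sub>C x"
    and scaleC_scaleC: "c *\<^sub>C d *\<^sub>C x = (c * d) *\<^sub>C x"
    and scaleC_complex_of_real: "complex_of_real r *\<^sub>C x = scaleR r x"
    and cinner_commute: "cinner x y = cnj (cinner y x)"
    and cinner_add_left: "cinner (x + y) z = cinner x z + cinner y z"
    and cinner_scaleC_left: "cinner (c *\<^sub>C x) y = cnj c * cinner x y"
    and inner_eq_Re_cinner: "inner x y = Re (cinner x y)"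

global_interpretation complex_vector:
  vector_space "scaleC :: complex \<Rightarrow> 'a \<Rightarrow> 'a::complex_inner"
proof
  show "1 *\<^sub>C x = x" for x :: 'a
    using scaleC_complex_of_real[of 1 x] by simp
qed (simp_all add: scaleC_add_right scaleC_add_left scaleC_scaleC)

instantiation complex :: complex_inner
begin

definition scaleC_complex :: "complex \<Rightarrow> complex \<Rightarrow> complex"
  where "scaleC_complex c x = c * x"

definition cinner_complex :: "complex \<Rightarrow> complex \<Rightarrow> complex"
  where "cinner_complex x y = cnj x * y"

instance
  by standard
    (simp_all add: scaleC_complex_def cinner_complex_def inner_complex_def scaleR_conv_of_real
      algebra_simps)

end

definition orthogonal_projection :: "('a::real_inner \<Rightarrow> 'a) \<Rightarrow> bool"
  where "orthogonal_projection P \<longleftrightarrow>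
    bounded_linear P \<and>
    (\<forall>x y. P x \<bullet> y = x \<bullet> P y) \<and>
    (\<forall>x. P (P x) = P x) \<and>
    (\<exists>S. subspace S \<and> closed S \<and> range P = S)"

definition complex_orthogonal_projection :: "('a::complex_inner \<Rightarrow> 'a) \<Rightarrow> bool"
  where "complex_orthogonal_projection P \<longleftrightarrow>
    bounded_linear P \<and> Vector_Spaces.linear (*\<^sub>C) (*\<^sub>C) P \<and>
    (\<forall>x y. cinner (P x) y = cinner x (P y)) \<and>
    (\<forall>x. P (P x) = P x) \<and>
    (\<exists>S. complex_vector.subspace S \<and> closed S \<and> range P = S)"

text \<open>The composition \<open>P n \<circ> P (n - 1) \<circ> \<dots> \<circ> P 1\<close>; the value \<open>P 0\<close> is not used.\<close>

primrec product_operator :: "(nat \<Rightarrow> 'a \<Rightarrow> 'a) \<Rightarrow> nat \<Rightarrow> 'a \<Rightarrow> 'a"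
  where
    "product_operator P 0 = id"
  | "product_operator P (Suc n) = P (Suc n) \<circ> product_operator P n"

end

theory Submission
  imports Defs "HOL-Real_Asymp.Real_Asymp"
begin

text \<open>
  All operators involved are contractions, so it suffices to find, for orthonormal \<open>e\<^sub>0, e\<^sub>1, \<dots>\<close>, words in
  five projections that map \<open>e\<^sub>n\<close> to within \<open>2\<^sup>-\<^sup>n\<^sup>-\<^sup>3\<close> of \<open>e\<^sub>n\<^sub>+\<^sub>1\<close>: the errors never grow, so
  the concatenated infinite word keeps visiting neighbourhoods of all the \<open>e\<^sub>n\<close>.

  Projecting successively onto lines along a fine quarter circle moves a unit vector \<open>u\<close> almost onto
  \<open>v\<close>. Perturb these lines in fresh orthogonal directions to make their spanning vectors
  \<open>h\<^sub>0, \<dots>, h\<^sub>k\<close> linearly independent. Then the line through \<open>h\<^sub>j\<close> is the intersection of the spans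
  of \<open>h\<^sub>0, \<dots>, h\<^sub>j\<close> and of \<open>h\<^sub>j, \<dots>, h\<^sub>k\<close>, so by von Neumann's theorem its projection is a limit of
  alternating products of projections from two chains of subspaces. All projections of a
  chain with largest member \<open>V\<close> are approximated by powers of a single product of two projections, onto \<open>V\<close> and a
  suitable \<open>A\<close>: on \<open>V\<close> that product is diagonal, and the eigenvalue \<open>\<lambda>\<^sub>i\<close> of the \<open>i\<close>-th step of the
  chain decreases so fast in \<open>i\<close> that some power is nearly 1 up to \<open>j\<close> and nearly 0 beyond.

  So a single transfer needs \<open>V\<close> and one subspace for each chain. Blocks \<open>n\<close> and \<open>n + 1\<close> overlap in
  \<open>e\<^sub>n\<^sub>+\<^sub>1\<close> only; hence the \<open>V\<close>s of all blocks can be merged into one subspace, while the chain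
  subspaces are merged separately over even and over odd blocks, which makes five.
\<close>

section \<open>Projections onto subspaces\<close>

definition proj :: "'a::real_inner set \<Rightarrow> 'a \<Rightarrow> 'a"
  where "proj S x = (SOME y. y \<in> S \<and> (\<forall>z\<in>S. (x - y) \<bullet> z = 0))"

text \<open>Existence of the decomposition is required instead of closedness, so that
  finite-dimensional subspaces and closed subspaces of a complete space are treated alike;
  closedness follows.\<close>

definition has_proj :: "'a::real_inner set \<Rightarrow> bool"
  where "has_proj S \<longleftrightarrow> subspace S \<and> (\<forall>x. \<exists>y\<in>S. \<forall>z\<in>S. (x - y) \<bullet> z = 0)"

lemma proj_eqI:
  assumes "subspace S" "y \<in> S" "\<And>z. z \<in> S \<Longrightarrow> (x - y) \<bullet> z = 0"
  shows "proj S x = y"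
  unfolding proj_def
proof (rule some_equality)
  fix y' assume y': "y' \<in> S \<and> (\<forall>z\<in>S. (x - y') \<bullet> z = 0)"
  have d: "y' - y \<in> S" using assms(1,2) y' by (simp add: subspace_diff)
  have "(y' - y) \<bullet> (y' - y) = (x - y) \<bullet> (y' - y) - (x - y') \<bullet> (y' - y)"
    by (simp add: inner_diff_left)
  also have "\<dots> = 0" using d y' assms(3) by simp
  finally show "y' = y" by simp
qed (use assms in auto)

lemma has_projD:
  assumes "has_proj S"
  shows has_proj_subspace: "subspace S" and proj_in: "proj S x \<in> S"
    and proj_orth: "z \<in> S \<Longrightarrow> (x - proj S x) \<bullet> z = 0"
proof -
  show "subspace S" using assms by (simp add: has_proj_def)
  have "\<exists>y. y \<in> S \<and> (\<forall>z\<in>S. (x - y) \<bullet> z = 0)" using assms unfolding has_proj_def by blast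
  from someI_ex[OF this]
  have "proj S x \<in> S \<and> (\<forall>z\<in>S. (x - proj S x) \<bullet> z = 0)" unfolding proj_def .
  then show "proj S x \<in> S" "z \<in> S \<Longrightarrow> (x - proj S x) \<bullet> z = 0" by auto
qed

lemma proj_id: "has_proj S \<Longrightarrow> x \<in> S \<Longrightarrow> proj S x = x"
  by (rule proj_eqI) (auto simp: has_proj_subspace)

lemma range_proj: "has_proj S \<Longrightarrow> range (proj S) = S"
  using proj_in proj_id by (metis image_subsetI rangeI subsetI subset_antisym)

lemma orthogonal_projection_proj:
  assumes "has_proj S"
  shows "orthogonal_projection (proj S)"
proof -
  note sub = has_proj_subspace[OF assms] and pin = proj_in[OF assms] and po = proj_orth[OF assms]
  have add: "proj S (x + y) = proj S x + proj S y" for x y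
    by (rule proj_eqI)
      (use sub pin po in \<open>auto simp: subspace_add add_diff_add inner_add_left\<close>)
  have scale: "proj S (c *\<^sub>R x) = c *\<^sub>R proj S x" for c x
  proof (rule proj_eqI)
    fix z assume "z \<in> S"
    then show "(c *\<^sub>R x - c *\<^sub>R proj S x) \<bullet> z = 0"
      using po[of z x] by (simp only: scaleR_diff_right[symmetric] inner_scaleR_left mult_zero_right)
  qed (use sub pin in \<open>auto simp: subspace_scale\<close>)
  have sa: "proj S x \<bullet> y = x \<bullet> proj S y" for x y
  proof -
    have "proj S x \<bullet> y = proj S x \<bullet> proj S y"
      using po[OF pin[of x], of y] by (simp add: inner_diff_left inner_diff_right inner_commute[of _ "proj S x"])
    also have "\<dots> = x \<bullet> proj S y"
      using po[OF pin[of y], of x] by (simp add: inner_diff_left)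
    finally show ?thesis .
  qed
  have idem: "proj S (proj S x) = proj S x" for x
    by (rule proj_id[OF assms pin])
  have le: "norm (proj S x) \<le> norm x" for x
  proof -
    have "norm (proj S x) ^ 2 = x \<bullet> proj S x"
      using sa[of x "proj S x"] by (simp add: idem power2_norm_eq_inner)
    also have "\<dots> \<le> norm x * norm (proj S x)" by (rule norm_cauchy_schwarz)
    finally have "norm (proj S x) * norm (proj S x) \<le> norm x * norm (proj S x)"
      by (simp add: power2_eq_square)
    then show ?thesis by (cases "norm (proj S x) = 0") auto
  qed
  have bl: "bounded_linear (proj S)"
    by (rule bounded_linear_intro[of _ 1]) (use add scale le in auto)
  note ran = range_proj[OF assms]
  \<comment> \<open>The range is the set of fixed points, which is closed because the projection is
    continuous.\<close>
  have "S = {x. proj S x = x}" using pin proj_id[OF assms] by (metis (mono_tags) Collect_eqI Collect_mem_eq)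
  moreover have "closed {x. proj S x = x}"
    by (intro closed_Collect_eq bounded_linear.continuous_on[OF bl] continuous_on_id)
  ultimately have "closed S" by simp
  then show ?thesis
    unfolding orthogonal_projection_def using bl sa idem ran sub by auto
qed

lemma has_proj_closed:
  assumes "has_proj S" shows "closed S"
  using orthogonal_projection_proj[OF assms] range_proj[OF assms]
  unfolding orthogonal_projection_def by auto

lemma orthogonal_projection_Pythagoras:
  assumes "orthogonal_projection P"
  shows "norm x ^ 2 = norm (P x) ^ 2 + norm (x - P x) ^ 2"
proof -
  have "P x \<bullet> P x = P (P x) \<bullet> x" "P (P x) = P x"
    using assms unfolding orthogonal_projection_def by (metis, metis)
  then have "P x \<bullet> P x = P x \<bullet> x" by simp
  then show ?thesis
    by (simp add: power2_norm_eq_inner inner_diff_left inner_diff_right inner_commute)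
qed

lemma orthogonal_projection_norm_le:
  assumes "orthogonal_projection P"
  shows "norm (P x) \<le> norm x"
  by (rule power2_le_imp_le)
    (use orthogonal_projection_Pythagoras[OF assms, of x] in auto)

text \<open>A minimising sequence for the distance from \<open>x\<close> to \<open>S\<close> is
  Cauchy by the parallelogram law. Its limit is a nearest point, and moving that point along any
  \<open>z\<close> in \<open>S\<close> shows that the residual is orthogonal to
  \<open>z\<close>.\<close>

lemma has_proj_closed_subspace:
  fixes S :: "'a::{real_inner,complete_space} set"
  assumes sub: "subspace S" and cl: "closed S"
  shows "has_proj S"
  unfolding has_proj_def
proof (intro conjI allI)
  fix x
  define d where "d = infdist x S"
  have ne: "S \<noteq> {}" using sub subspace_0 by blast
  have dle: "d \<le> norm (x - y)" if "y \<in> S" for y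
    using infdist_le[OF that, of x] by (simp add: d_def dist_norm)
  have d0: "d \<ge> 0" by (simp add: d_def infdist_nonneg)
  have "\<exists>y\<in>S. norm (x - y) < d + 1 / Suc n" for n
  proof (rule ccontr)
    assume "\<not> ?thesis"
    then have "d + 1 / Suc n \<le> infdist x S"
      unfolding infdist_notempty[OF ne] by (intro cINF_greatest[OF ne]) (auto simp: dist_norm not_less)
    then show False by (simp add: d_def divide_simps split: if_splits)
  qed
  then obtain y where y: "\<And>n. y n \<in> S" "\<And>n. norm (x - y n) < d + 1 / Suc n" by metis
  have lim: "(\<lambda>n. norm (x - y n)) \<longlonglongrightarrow> d"
  proof (rule tendsto_sandwich[of "\<lambda>_. d" _ _ "\<lambda>n. d + 1 / Suc n"])
    show "\<forall>\<^sub>F n in sequentially. d \<le> norm (x - y n)" using dle y by auto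
    show "\<forall>\<^sub>F n in sequentially. norm (x - y n) \<le> d + 1 / real (Suc n)"
      by (intro always_eventually allI less_imp_le y(2))
    show "(\<lambda>n. d + 1 / Suc n) \<longlonglongrightarrow> d"
      using tendsto_add[OF tendsto_const LIMSEQ_inverse_real_of_nat, of d]
      by (simp add: inverse_eq_divide)
  qed auto
  have par: "norm (y m - y n) ^ 2 \<le> 2 * norm (x - y m) ^ 2 + 2 * norm (x - y n) ^ 2 - 4 * d ^ 2" for m n
  proof -
    \<comment> \<open>The midpoint of \<open>y m\<close> and \<open>y n\<close> lies in
      \<open>S\<close>, so its distance from \<open>x\<close> is at least \<open>d\<close>.\<close>
    define w where "w = (1/2) *\<^sub>R (y m + y n)"
    have "w \<in> S" using sub y by (auto simp: w_def intro: subspace_scale subspace_add)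
    then have "d ^ 2 \<le> norm (x - w) ^ 2" using dle d0 by (simp add: power_mono)
    moreover have "norm (y m - y n) ^ 2 + 4 * norm (x - w) ^ 2
        = 2 * norm (x - y m) ^ 2 + 2 * norm (x - y n) ^ 2"
      unfolding power2_norm_eq_inner w_def by (simp add: inner_simps inner_commute algebra_simps)
    ultimately show ?thesis by linarith
  qed
  have "Cauchy y"
  proof (rule metric_CauchyI)
    fix e :: real assume e: "e > 0"
    have "(\<lambda>n. norm (x - y n) ^ 2) \<longlonglongrightarrow> d ^ 2" by (intro tendsto_power lim)
    then have "\<forall>\<^sub>F n in sequentially. norm (x - y n) ^ 2 < d ^ 2 + e^2/4"
      by (rule order_tendstoD) (use e in auto)
    then obtain N where N: "\<And>n. n \<ge> N \<Longrightarrow> norm (x - y n) ^ 2 < d ^ 2 + e^2/4"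
      by (auto simp: eventually_sequentially)
    show "\<exists>M. \<forall>m\<ge>M. \<forall>n\<ge>M. dist (y m) (y n) < e"
    proof (intro exI[of _ N] allI impI)
      fix m n assume "m \<ge> N" "n \<ge> N"
      then have "norm (y m - y n) ^ 2 < e ^ 2" using par[of m n] N[of m] N[of n] by linarith
      then show "dist (y m) (y n) < e" using e by (simp add: dist_norm power_less_imp_less_base)
    qed
  qed
  then obtain l where l: "y \<longlonglongrightarrow> l" using Cauchy_convergent_iff convergent_def by blast
  have lS: "l \<in> S" using closed_sequentially[OF cl _ l] y by blast
  have nl: "norm (x - l) = d"
    by (rule LIMSEQ_unique[OF _ lim]) (intro tendsto_norm tendsto_diff tendsto_const l)
  have "(x - l) \<bullet> z = 0" if z: "z \<in> S" for z
  proof (cases "z = 0")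
    case False
    \<comment> \<open>This \<open>t\<close> minimises the distance from \<open>x\<close> to
      \<open>l + t *\<^sub>R z\<close>; as \<open>l\<close> is already nearest, nothing can be
      gained.\<close>
    define t where "t = ((x - l) \<bullet> z) / (z \<bullet> z)"
    have zz: "z \<bullet> z > 0" using False by simp
    have "l + t *\<^sub>R z \<in> S" using lS z sub by (simp add: subspace_add subspace_scale)
    then have "norm (x - l) ^ 2 \<le> norm (x - (l + t *\<^sub>R z)) ^ 2"
      using dle nl d0 by (metis power_mono)
    also have "\<dots> = norm (x - l) ^ 2 - 2 * t * ((x - l) \<bullet> z) + t * t * (z \<bullet> z)"
      unfolding power2_norm_eq_inner by (simp add: inner_simps inner_commute algebra_simps)
    also have "\<dots> = norm (x - l) ^ 2 - ((x - l) \<bullet> z) ^ 2 / (z \<bullet> z)"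
      using zz by (simp add: t_def field_simps power2_eq_square)
    finally have "((x - l) \<bullet> z) ^ 2 / (z \<bullet> z) \<le> 0" by simp
    then have "((x - l) \<bullet> z) ^ 2 \<le> 0" using zz by (simp add: divide_le_0_iff)
    then show ?thesis by simp
  qed simp
  then show "\<exists>y\<in>S. \<forall>z\<in>S. (x - y) \<bullet> z = 0" using lS by blast
qed (rule sub)

lemma orthogonal_span:
  fixes x :: "'a::real_inner"
  assumes "\<And>y. y \<in> B \<Longrightarrow> x \<bullet> y = 0" "z \<in> span B"
  shows "x \<bullet> z = 0"
  using assms(2) by (induction rule: span_induct_alt) (auto simp: assms(1) inner_simps)

lemma has_proj_span_finite:
  fixes B :: "'a::real_inner set"
  assumes "finite B"
  shows "has_proj (span B)"
  unfolding has_proj_def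
proof (intro conjI allI)
  fix x :: 'a
  obtain C where C: "finite C" "span C = span B" "pairwise orthogonal C"
    using basis_orthogonal[OF assms] by blast
  \<comment> \<open>The orthogonal set \<open>C\<close> may contain 0; division by zero then gives a
    zero coefficient, which does no harm.\<close>
  define y where "y = (\<Sum>c\<in>C. ((x \<bullet> c) / (c \<bullet> c)) *\<^sub>R c)"
  have "(x - y) \<bullet> c = 0" if c: "c \<in> C" for c
  proof -
    have "y \<bullet> c = (\<Sum>b\<in>C. ((x \<bullet> b) / (b \<bullet> b)) * (b \<bullet> c))"
      by (simp add: y_def inner_sum_left)
    also have "\<dots> = (\<Sum>b\<in>C. if b = c then ((x \<bullet> c) / (c \<bullet> c)) * (c \<bullet> c) else 0)"
      by (rule sum.cong) (use C(3) c in \<open>auto simp: pairwise_def orthogonal_def\<close>)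
    also have "\<dots> = x \<bullet> c" using C(1) c by (auto simp: sum.delta)
    finally show ?thesis by (simp add: inner_diff_left)
  qed
  then have "\<forall>z\<in>span B. (x - y) \<bullet> z = 0" using orthogonal_span[of C] C(2) by metis
  moreover have "y \<in> span B"
    unfolding y_def C(2)[symmetric] by (intro span_sum span_scale span_base)
  ultimately show "\<exists>y\<in>span B. \<forall>z\<in>span B. (x - y) \<bullet> z = 0" by blast
qed (rule subspace_span)

text \<open>
  With \<open>U = PRP\<close> for the two projections \<open>P\<close> and \<open>R\<close>, the numbers \<open>a\<^sub>n\<close> given by the inner product of \<open>U\<^sup>nx\<close> and \<open>x\<close>
  decrease and \<open>U\<^sup>mx - U\<^sup>nx\<close> has squared norm \<open>a\<^sub>2\<^sub>m - 2a\<^sub>m\<^sub>+\<^sub>n + a\<^sub>2\<^sub>n\<close>, so the iterates form a Cauchy sequence.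
\<close>
lemma von_Neumann_alternating:
  fixes S T :: "'a::{real_inner,complete_space} set"
  assumes S: "has_proj S" and T: "has_proj T"
  shows "(\<lambda>n. ((\<lambda>y. proj S (proj T (proj S y))) ^^ n) x) \<longlonglongrightarrow> proj (S \<inter> T) x"
proof -
  let ?E = "proj S" let ?F = "proj T"
  define U where "U = (\<lambda>y. ?E (?F (?E y)))"
  define a where "a n = (U ^^ n) x \<bullet> x" for n
  have oE: "orthogonal_projection ?E" and oF: "orthogonal_projection ?F"
    using S T by (auto intro: orthogonal_projection_proj)
  have saE: "?E u \<bullet> v = u \<bullet> ?E v" and saF: "?F u \<bullet> v = u \<bullet> ?F v"
    and iE: "?E (?E u) = ?E u" and iF: "?F (?F u) = ?F u" for u v
    using oE oF unfolding orthogonal_projection_def by blast+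
  have saU: "U u \<bullet> v = u \<bullet> U v" for u v by (simp add: U_def saE saF)
  have saUn: "(U ^^ n) u \<bullet> v = u \<bullet> (U ^^ n) v" for n u v
  proof (induction n arbitrary: v)
    case (Suc n)
    have "(U ^^ Suc n) u \<bullet> v = u \<bullet> (U ^^ n) (U v)" by (simp add: saU Suc)
    then show ?case by (simp only: funpow_Suc_right o_apply)
  qed simp
  have a_add: "(U ^^ m) x \<bullet> (U ^^ n) x = a (m + n)" for m n
  proof -
    have "a (m + n) = (U ^^ n) ((U ^^ m) x) \<bullet> x"
      by (simp add: a_def add.commute[of m] funpow_add)
    then show ?thesis by (simp only: saUn)
  qed
  have aeven: "a (m + m) = norm ((U ^^ m) x) ^ 2" for m
    by (simp add: power2_norm_eq_inner a_add)
  \<comment> \<open>The odd terms are squared norms taken half-way through a round, so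
    \<open>a\<close> follows the squared norm through successive contractions and decreases.\<close>
  have aodd: "a (Suc (m + m)) = norm (?F (?E ((U ^^ m) x))) ^ 2" for m
  proof -
    have "a (Suc (m + m)) = U ((U ^^ m) x) \<bullet> (U ^^ m) x" using a_add[of "Suc m" m] by simp
    also have "\<dots> = ?F (?E ((U ^^ m) x)) \<bullet> ?F (?E ((U ^^ m) x))" by (simp add: U_def saE saF iF)
    finally show ?thesis by (simp add: power2_norm_eq_inner)
  qed
  have nE: "norm (?E u) \<le> norm u" and nF: "norm (?F u) \<le> norm u" for u
    using oE oF orthogonal_projection_norm_le by blast+
  have dec: "a (Suc n) \<le> a n" for n
  proof (cases "even n")
    case True
    then obtain m where "n = m + m" by (metis evenE mult_2)
    then show ?thesis unfolding \<open>n = m + m\<close> aeven aodd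
      by (intro power_mono) (auto intro: order_trans nE nF)
  next
    case False
    then obtain m where n: "n = Suc (m + m)" by (metis oddE mult_2 Suc_eq_plus1)
    have "a (Suc n) = norm (U ((U ^^ m) x)) ^ 2" using aeven[of "Suc m"] n by simp
    also have "\<dots> \<le> norm (?F (?E ((U ^^ m) x))) ^ 2"
      unfolding U_def by (intro power_mono nE) auto
    finally show ?thesis unfolding n aodd .
  qed
  have pos: "a n \<ge> 0" for n
  proof (cases "even n")
    case True
    then obtain m where "n = m + m" by (metis evenE mult_2)
    then show ?thesis by (simp add: aeven)
  next
    case False
    then obtain m where "n = Suc (m + m)" by (metis oddE mult_2 Suc_eq_plus1)
    then show ?thesis by (simp add: aodd)
  qed
  obtain A where A: "a \<longlonglongrightarrow> A"
    using decseq_convergent[of a 0] dec pos unfolding decseq_Suc_iff by metis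
  have "Cauchy (\<lambda>n. (U ^^ n) x)"
  proof (rule metric_CauchyI)
    fix e :: real assume e: "e > 0"
    then obtain N where N: "\<And>n. n \<ge> N \<Longrightarrow> norm (a n - A) < e^2/4"
      using LIMSEQ_D[OF A, of "e^2/4"] by auto
    have N': "a n < A + e^2/4" "A - e^2/4 < a n" if "n \<ge> N" for n
      using N[OF that] by (simp_all only: real_norm_def abs_less_iff) linarith+
    show "\<exists>M. \<forall>m\<ge>M. \<forall>n\<ge>M. dist ((U ^^ m) x) ((U ^^ n) x) < e"
    proof (intro exI[of _ N] allI impI)
      fix m n assume mn: "m \<ge> N" "n \<ge> N"
      have "norm ((U ^^ m) x - (U ^^ n) x) ^ 2 = a (m + m) - 2 * a (m + n) + a (n + n)"
        unfolding power2_norm_eq_inner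
        by (simp add: inner_diff_left inner_diff_right a_add add.commute)
      also have "\<dots> < e^2"
        using N'(1)[of "m + m"] N'(2)[of "m + n"] N'(1)[of "n + n"] mn by linarith
      finally show "dist ((U ^^ m) x) ((U ^^ n) x) < e"
        using e by (simp add: dist_norm power_less_imp_less_base)
    qed
  qed
  then obtain y where y: "(\<lambda>n. (U ^^ n) x) \<longlonglongrightarrow> y"
    using Cauchy_convergent_iff convergent_def by blast
  have bl: "bounded_linear U" unfolding U_def
    using oE oF by (auto simp: orthogonal_projection_def intro!: bounded_linear_compose[of "proj _"])
  have "(\<lambda>n. U ((U ^^ n) x)) \<longlonglongrightarrow> U y" by (rule bounded_linear.tendsto[OF bl y])
  moreover have "(\<lambda>n. U ((U ^^ n) x)) \<longlonglongrightarrow> y" using LIMSEQ_Suc[OF y] by simp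
  ultimately have Uy: "U y = y" using LIMSEQ_unique by blast
  have yS: "y \<in> S" using Uy proj_in[OF S] unfolding U_def by metis
  then have Ey: "?E y = y" using proj_id[OF S] by blast
  \<comment> \<open>Here \<open>y = ?E (?F y)\<close>, so \<open>?F\<close> cannot shorten
    \<open>y\<close>; by Pythagoras it fixes \<open>y\<close>.\<close>
  have "norm y \<le> norm (?F y)" using Uy nE[of "?F y"] unfolding U_def Ey by simp
  then have "norm y ^ 2 \<le> norm (?F y) ^ 2" by (simp add: power_mono)
  then have "norm (y - ?F y) ^ 2 \<le> 0" using orthogonal_projection_Pythagoras[OF oF, of y] by linarith
  then have "?F y = y" by simp
  then have yT: "y \<in> T" using proj_in[OF T] by metis
  have "proj (S \<inter> T) x = y"
  proof (rule proj_eqI)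
    show "subspace (S \<inter> T)" using S T by (simp add: has_proj_def subspace_inter)
    fix z assume z: "z \<in> S \<inter> T"
    \<comment> \<open>The self-adjoint \<open>U\<close> fixes the intersection pointwise, so inner
      products with its vectors stay constant along the iteration.\<close>
    then have Uz: "U z = z" by (simp add: U_def proj_id[OF S] proj_id[OF T])
    have "(U ^^ n) z = z" for n by (induction n) (simp_all add: Uz)
    then have "(U ^^ n) x \<bullet> z = x \<bullet> z" for n by (simp add: saUn)
    moreover have "(\<lambda>n. (U ^^ n) x \<bullet> z) \<longlonglongrightarrow> y \<bullet> z" by (intro tendsto_inner y tendsto_const)
    ultimately have "x \<bullet> z = y \<bullet> z" by (simp add: LIMSEQ_const_iff)
    then show "(x - y) \<bullet> z = 0" by (simp add: inner_diff_left)
  qed (use yS yT in auto)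
  then show ?thesis using y unfolding U_def by simp
qed

section \<open>Approximating a chain of projections by powers of one product\<close>

lemma has_proj_bounded_linear: "has_proj S \<Longrightarrow> bounded_linear (proj S)"
  using orthogonal_projection_proj unfolding orthogonal_projection_def by blast

lemma linear_funpow:
  fixes f :: "'a::real_vector \<Rightarrow> 'a"
  assumes "linear f"
  shows "linear (f ^^ n)"
proof (induction n)
  case 0
  show ?case by (simp add: linear_id[unfolded id_def] id_def)
next
  case (Suc n)
  show ?case using linear_compose[OF Suc assms] by (simp only: funpow.simps)
qed

text \<open>The argument of the exponential becomes minus \<open>q\<close> to the power
  \<open>2 * (i - j) - 1\<close>, read in the integers. This power is odd, hence never zero:
  negative for \<open>i \<le> j\<close> and positive otherwise.\<close>

lemma tendsto_chain_eigenvalue: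
  assumes "j \<le> m"
  shows "(\<lambda>q. exp (- (real q ^ (2 * i) / real q ^ (2 * m + 1))) ^ (q ^ (2 * (m - j))))
    \<longlonglongrightarrow> (if i \<le> j then 1 else 0)"
proof -
  have eq: "exp (- (real q ^ (2 * i) / real q ^ (2 * m + 1))) ^ (q ^ (2 * (m - j)))
      = exp (- (real q ^ (2 * (m - j) + 2 * i) / real q ^ (2 * m + 1)))" for q
    by (simp add: exp_of_nat_mult[symmetric] power_add)
  show ?thesis
  proof (cases "i \<le> j")
    case True
    have eq2: "real q ^ (2 * (m - j) + 2 * i) / real q ^ (2 * m + 1) = inverse (real q) ^ Suc (2 * (j - i))"
      if "q > 0" for q
    proof -
      have e: "2 * m + 1 = (2 * (m - j) + 2 * i) + Suc (2 * (j - i))" using True assms by simp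
      show ?thesis unfolding e power_add using that by (simp add: field_simps)
    qed
    have "(\<lambda>q. inverse (real q) ^ Suc (2 * (j - i))) \<longlonglongrightarrow> 0 ^ Suc (2 * (j - i))"
      by (intro tendsto_power lim_inverse_n)
    then have "(\<lambda>q. real q ^ (2 * (m - j) + 2 * i) / real q ^ (2 * m + 1)) \<longlonglongrightarrow> 0"
      by (subst tendsto_cong[where g = "\<lambda>q. inverse (real q) ^ Suc (2 * (j - i))"])
        (auto simp only: power_0_Suc intro!: eventually_mono[OF eventually_gt_at_top[of 0]] eq2)
    then have "(\<lambda>q. exp (- (real q ^ (2 * (m - j) + 2 * i) / real q ^ (2 * m + 1)))) \<longlonglongrightarrow> exp (- 0)"
      by (intro tendsto_exp tendsto_minus)
    then show ?thesis unfolding eq using True by simp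
  next
    case False
    have eq2: "real q ^ (2 * (m - j) + 2 * i) / real q ^ (2 * m + 1) = real q ^ (2 * (i - j) - 1)"
      if "q > 0" for q
    proof -
      have e: "2 * (m - j) + 2 * i = (2 * m + 1) + (2 * (i - j) - 1)" using False assms by simp
      show ?thesis unfolding e power_add using that by simp
    qed
    have "filterlim (\<lambda>q. real q ^ (2 * (i - j) - 1)) at_top sequentially"
      by (rule filterlim_pow_at_top) (use False filterlim_real_sequentially in auto)
    then have "filterlim (\<lambda>q. real q ^ (2 * (m - j) + 2 * i) / real q ^ (2 * m + 1)) at_top sequentially"
      by (subst filterlim_cong[OF refl refl, where g = "\<lambda>q. real q ^ (2 * (i - j) - 1)"])
        (auto simp only: intro!: eventually_mono[OF eventually_gt_at_top[of 0]] eq2)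
    then have "(\<lambda>q. exp (- (real q ^ (2 * (m - j) + 2 * i) / real q ^ (2 * m + 1)))) \<longlonglongrightarrow> 0"
      by (intro filterlim_compose[OF exp_at_bot] filterlim_compose[OF filterlim_uminus_at_bot_at_top])
    then show ?thesis unfolding eq using False by simp
  qed
qed

text \<open>Gram-Schmidt turns \<open>h\<close> into an orthogonal \<open>f\<close>. Tilting each
  \<open>f i\<close> towards its own direction \<open>g i\<close>, with squared cosine
  \<open>l q i\<close>, makes projecting to \<open>A q\<close> and back multiply \<open>f i\<close>
  by \<open>l q i\<close>. As \<open>A q\<close> does not depend on \<open>j\<close>, the exponent
  alone selects the member of the chain.\<close>

lemma chain_approximation:
  fixes h g :: "nat \<Rightarrow> 'a::real_inner"
  assumes g: "\<And>i j. g i \<bullet> g j = (if i = j then 1 else 0)"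
    and gh: "\<And>i j. j \<le> m \<Longrightarrow> g i \<bullet> h j = 0"
  obtains A :: "nat \<Rightarrow> 'a set" where
    "\<And>q. has_proj (A q)"
    "\<And>q. A q \<subseteq> span (h ` {..m} \<union> range g)"
    "\<And>j. j \<le> m \<Longrightarrow> \<exists>s. \<forall>x\<in>span (h ` {..m}).
       (\<lambda>q. ((\<lambda>y. proj (span (h ` {..m})) (proj (A q) y)) ^^ s q) x) \<longlonglongrightarrow> proj (span (h ` {..j})) x"
proof -
  define f where "f i = h i - proj (span (h ` {..<i})) (h i)" for i
  \<comment> \<open>Neighbouring indices differ by a factor \<open>q^2\<close> inside the
    exponential, which leaves room for a power of \<open>l q i\<close> to separate indices up to
    \<open>j\<close> from larger ones.\<close>
  define l where "l q i = exp (- (real q ^ (2 * i) / real q ^ (2 * m + 1)))" for q i :: nat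
  \<comment> \<open>The \<open>f i\<close> are not normalised and may vanish; the factor \<open>norm (f i)\<close> below makes \<open>a q i\<close> as long as \<open>f i\<close>.\<close>
  define a where "a q i = sqrt (l q i) *\<^sub>R f i + (sqrt (1 - l q i) * norm (f i)) *\<^sub>R g i" for q i
  define A where "A q = span (a q ` {..m})" for q
  define V where "V = span (h ` {..m})"
  have hp: "has_proj (span (h ` {..<i}))" "has_proj (span (h ` {..i}))" for i
    by (simp_all add: has_proj_span_finite)
  have hpA: "has_proj (A q)" for q unfolding A_def by (simp add: has_proj_span_finite)
  have hpV: "has_proj V" unfolding V_def by (rule hp)
  have span_f: "span (f ` {..<n}) = span (h ` {..<n})" for n
  proof (induction n)
    case (Suc n)
    have "span (insert (f n) (f ` {..<n})) = span (insert (f n) (h ` {..<n}))"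
      using Suc by (simp only: span_insert)
    also have "\<dots> = span (insert (h n) (h ` {..<n}))"
      by (rule eq_span_insert_eq) (simp add: f_def span_neg proj_in[OF hp(1)])
    finally show ?case by (simp add: lessThan_Suc)
  qed simp
  have span_f': "span (f ` {..n}) = span (h ` {..n})" for n
    using span_f[of "Suc n"] by (simp add: lessThan_Suc_atMost)
  have f_lt: "f j \<bullet> f i = 0" if "i < j" for i j
  proof -
    have "f i \<in> span (h ` {..<j})" using that unfolding span_f[of j, symmetric] by (auto intro: span_base)
    then show ?thesis using proj_orth[OF hp(1)] unfolding f_def[of j] by blast
  qed
  have ff: "f i \<bullet> f j = 0" if "i \<noteq> j" for i j
    using f_lt[of i j] f_lt[of j i] that by (metis inner_commute linorder_neqE_nat)
  have fV: "f i \<in> V" if "i \<le> m" for i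
    unfolding V_def span_f'[symmetric] using that by (auto intro: span_base)
  have gV: "g i \<bullet> x = 0" if "x \<in> V" for i x
    using orthogonal_span[of "h ` {..m}" "g i" x] gh that unfolding V_def by auto
  have l01: "0 \<le> l q i" "l q i \<le> 1" for q i
    by (auto simp: l_def)
  have gf: "g i \<bullet> f j = 0" "f j \<bullet> g i = 0" if "j \<le> m" for i j
    using gV fV[OF that] by (auto simp: inner_commute)
  have aV: "a q i \<in> span (h ` {..m} \<union> range g)" if "i \<le> m" for q i
  proof -
    have "f i \<in> span (h ` {..m} \<union> range g)"
      using fV[OF that] span_mono[of "h ` {..m}" "h ` {..m} \<union> range g"] unfolding V_def by blast
    then show ?thesis unfolding a_def by (intro span_add span_scale) (auto intro: span_base)
  qed
  have pA: "proj (A q) (f i) = sqrt (l q i) *\<^sub>R a q i" if i: "i \<le> m" for q i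
  proof (rule proj_eqI)
    show "subspace (A q)" by (simp add: A_def)
    show "sqrt (l q i) *\<^sub>R a q i \<in> A q"
      unfolding A_def using i by (intro span_scale span_base imageI) simp
    fix z assume z: "z \<in> A q"
    have "(f i - sqrt (l q i) *\<^sub>R a q i) \<bullet> a q k = 0" if k: "k \<le> m" for k
    proof (cases "k = i")
      case True
      have "sqrt (l q i) * sqrt (l q i) = l q i" "sqrt (1 - l q i) * sqrt (1 - l q i) = 1 - l q i"
        using l01 by auto
      then have sq: "sqrt (l q i) * (sqrt (l q i) * w) = l q i * w"
         "sqrt (1 - l q i) * (sqrt (1 - l q i) * w) = (1 - l q i) * w" for w
        by (simp_all flip: mult.assoc)
      have nf: "norm (f i) * norm (f i) = f i \<bullet> f i"
        by (simp flip: power2_eq_square add: power2_norm_eq_inner)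
      have "a q i \<bullet> a q i = l q i * (f i \<bullet> f i) + (1 - l q i) * (f i \<bullet> f i)"
        by (simp add: a_def inner_add_left inner_add_right gf[OF i] g sq nf[symmetric] ac_simps l01)
      then have "a q i \<bullet> a q i = f i \<bullet> f i" by (simp add: algebra_simps)
      moreover have "f i \<bullet> a q i = sqrt (l q i) * (f i \<bullet> f i)"
        by (simp add: a_def inner_add_right gf[OF i])
      ultimately show ?thesis unfolding True by (simp add: inner_diff_left)
    next
      case False
      then show ?thesis
        using i k by (simp add: a_def inner_simps gf g ff)
    qed
    then show "(f i - sqrt (l q i) *\<^sub>R a q i) \<bullet> z = 0"
      using orthogonal_span[of "a q ` {..m}"] z unfolding A_def by blast
  qed
  have pV: "proj V (a q i) = sqrt (l q i) *\<^sub>R f i" if i: "i \<le> m" for q i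
  proof (rule proj_eqI)
    show "subspace V" by (simp add: V_def)
    show "sqrt (l q i) *\<^sub>R f i \<in> V" using fV[OF i] by (simp add: V_def span_scale)
    show "(a q i - sqrt (l q i) *\<^sub>R f i) \<bullet> z = 0" if "z \<in> V" for z
      using gV[OF that] by (simp add: a_def)
  qed
  define U where "U q = (\<lambda>y. proj V (proj (A q) y))" for q
  have linV: "linear (proj V)" and linA: "linear (proj (A q))" and linE: "linear (proj (span (h ` {..j})))" for q j
    using has_proj_bounded_linear hpV hpA hp(2) bounded_linear.linear by blast+
  have "linear (U q)" for q
    using linear_compose[OF linA linV] unfolding U_def o_def .
  then have linU: "linear (U q ^^ n)" for q n by (rule linear_funpow)
  have Uf: "(U q ^^ n) (f i) = (l q i ^ n) *\<^sub>R f i" if i: "i \<le> m" for q n i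
  proof (induction n)
    case (Suc n)
    have "U q (f i) = l q i *\<^sub>R f i"
      using l01 by (simp add: U_def pA[OF i] linear_scale[OF linV] pV[OF i])
    then show ?case using Suc by (simp add: linear_scale[OF \<open>linear (U q)\<close>] mult.commute)
  qed simp
  show thesis
  proof (rule that[of A])
    show "has_proj (A q)" for q by (rule hpA)
    show "A q \<subseteq> span (h ` {..m} \<union> range g)" for q
      unfolding A_def by (rule span_minimal) (use aV in auto)
    fix j assume j: "j \<le> m"
    define s where "s q = q ^ (2 * (m - j))" for q :: nat
    have "(\<lambda>q. (U q ^^ s q) x) \<longlonglongrightarrow> proj (span (h ` {..j})) x" if "x \<in> V" for x
    proof -
      from that have "x \<in> span (f ` {..m})" by (simp add: V_def span_f')
      then show ?thesis
      proof (induction rule: span_induct_alt)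
        case base
        show ?case by (simp add: linear_0[OF linU] linear_0[OF linE])
      next
        case (step c x y)
        then obtain i where i: "i \<le> m" "x = f i" by auto
        have pe: "proj (span (h ` {..j})) (f i) = (if i \<le> j then 1 else 0) *\<^sub>R f i"
        proof (cases "i \<le> j")
          case True
          then have "f i \<in> span (h ` {..j})" unfolding span_f'[symmetric] by (auto intro: span_base)
          then show ?thesis using True by (simp add: proj_id[OF hp(2)])
        next
          case False
          have "f i \<bullet> z = 0" if "z \<in> span (f ` {..j})" for z
            by (rule orthogonal_span[OF _ that]) (use False in \<open>auto intro: ff\<close>)
          then show ?thesis using False
            by (intro proj_eqI) (auto simp: span_f' span_zero)
        qed
        have "(\<lambda>q. (U q ^^ s q) (f i)) \<longlonglongrightarrow> proj (span (h ` {..j})) (f i)"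
          unfolding Uf[OF i(1)] pe s_def l_def
          by (intro tendsto_scaleR tendsto_chain_eigenvalue[OF j] tendsto_const)
        then have "(\<lambda>q. c *\<^sub>R (U q ^^ s q) (f i) + (U q ^^ s q) y)
          \<longlonglongrightarrow> c *\<^sub>R proj (span (h ` {..j})) (f i) + proj (span (h ` {..j})) y"
          by (intro tendsto_add tendsto_scaleR tendsto_const step)
        then show ?case
          by (simp add: i linear_add[OF linU] linear_add[OF linE] linear_scale[OF linU] linear_scale[OF linE])
      qed
    qed
    then show "\<exists>s. \<forall>x\<in>span (h ` {..m}).
       (\<lambda>q. ((\<lambda>y. proj (span (h ` {..m})) (proj (A q) y)) ^^ s q) x) \<longlonglongrightarrow> proj (span (h ` {..j})) x"
      unfolding U_def V_def by blast
  qed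
qed

section \<open>Transferring a unit vector\<close>

text \<open>The word may depend on \<open>q\<close> but must exist for all large \<open>q\<close>,
  not just for infinitely many; finitely many such statements then share a common
  \<open>q\<close>.\<close>

definition reach :: "(nat \<Rightarrow> 'i \<Rightarrow> 'a \<Rightarrow> 'a) \<Rightarrow> 'i set \<Rightarrow> 'a::metric_space \<Rightarrow> 'a \<Rightarrow> bool"
  where "reach Q I x y \<longleftrightarrow>
    (\<forall>e>0. \<forall>\<^sub>F q in sequentially. \<exists>w. set w \<subseteq> I \<and> dist (fold (Q q) w x) y < e)"

lemma fold_contraction:
  assumes "\<And>i x y. i \<in> I \<Longrightarrow> dist (Q i x) (Q i y) \<le> dist x y" "set w \<subseteq> I"
  shows "dist (fold Q w x) (fold Q w y) \<le> dist x y"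
  using assms(2)
proof (induction w arbitrary: x y)
  case (Cons i w)
  then show ?case using assms(1)[of i x y] by (fastforce intro: order_trans)
qed simp

text \<open>The second word is a contraction, so it does not enlarge the error left by the
  first.\<close>

lemma reach_trans:
  assumes "\<And>q i x y. i \<in> I \<Longrightarrow> dist (Q q i x) (Q q i y) \<le> dist x y"
    and xy: "reach Q I x y" and yz: "reach Q I y z"
  shows "reach Q I x z"
  unfolding reach_def
proof (intro allI impI)
  fix e :: real assume "e > 0"
  then have "e / 2 > 0" by simp
  from xy[unfolded reach_def, rule_format, OF this] yz[unfolded reach_def, rule_format, OF this]
  show "\<forall>\<^sub>F q in sequentially. \<exists>w. set w \<subseteq> I \<and> dist (fold (Q q) w x) z < e"
  proof eventually_elim
    case (elim q)
    then obtain w w' where w: "set w \<subseteq> I" "dist (fold (Q q) w x) y < e / 2"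
      "set w' \<subseteq> I" "dist (fold (Q q) w' y) z < e / 2" by blast
    have "dist (fold (Q q) w' (fold (Q q) w x)) (fold (Q q) w' y) \<le> dist (fold (Q q) w x) y"
      by (rule fold_contraction[OF assms(1) w(3)])
    then have "dist (fold (Q q) w' (fold (Q q) w x)) z < e"
      using w(2,4) dist_triangle[of "fold (Q q) w' (fold (Q q) w x)" z "fold (Q q) w' y"] by linarith
    then show ?case using w by (intro exI[of _ "w @ w'"]) simp
  qed
qed

lemma reach_limit:
  assumes "\<And>n::nat. reach Q I x (y n)" "y \<longlonglongrightarrow> l"
  shows "reach Q I x l"
  unfolding reach_def
proof (intro allI impI)
  fix e :: real assume "e > 0"
  then have e: "e / 2 > 0" by simp
  then obtain n where n: "dist (y n) l < e / 2"
    using assms(2) unfolding lim_sequentially by blast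
  from assms(1)[of n, unfolded reach_def, rule_format, OF e]
  show "\<forall>\<^sub>F q in sequentially. \<exists>w. set w \<subseteq> I \<and> dist (fold (Q q) w x) l < e"
  proof eventually_elim
    case (elim q)
    then obtain w where w: "set w \<subseteq> I" "dist (fold (Q q) w x) (y n) < e / 2" by blast
    then show ?case
      using n dist_triangle[of "fold (Q q) w x" l "y n"] by (intro exI[of _ w]) linarith
  qed
qed

lemma fold_concat_replicate:
  "fold Q (concat (replicate s [a, b])) x = ((\<lambda>y. Q b (Q a y)) ^^ s) x"
  by (induction s arbitrary: x) (simp_all add: funpow_Suc_right del: funpow.simps(2))

lemma reach_alternating:
  assumes "(\<lambda>q. ((\<lambda>y. Q q b (Q q a y)) ^^ s q) x) \<longlonglongrightarrow> y" "a \<in> I" "b \<in> I"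
  shows "reach Q I x y"
  unfolding reach_def
proof (intro allI impI)
  fix e :: real assume "e > 0"
  with assms(1) have "\<forall>\<^sub>F q in sequentially. dist (((\<lambda>y. Q q b (Q q a y)) ^^ s q) x) y < e"
    by (rule tendstoD)
  then show "\<forall>\<^sub>F q in sequentially. \<exists>w. set w \<subseteq> I \<and> dist (fold (Q q) w x) y < e"
  proof eventually_elim
    case (elim q)
    have "set (concat (replicate (s q) [a, b])) \<subseteq> I" using assms by auto
    with elim show ?case
      by (intro exI[of _ "concat (replicate (s q) [a, b])"]) (simp only: fold_concat_replicate)
  qed
qed

lemma proj_contraction:
  assumes "has_proj S"
  shows "dist (proj S x) (proj S y) \<le> dist x y"
proof -
  have "proj S x - proj S y = proj S (x - y)"
    using linear_diff[OF bounded_linear.linear[OF has_proj_bounded_linear[OF assms]]] by simp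
  then show ?thesis
    using orthogonal_projection_norm_le[OF orthogonal_projection_proj[OF assms]] by (simp add: dist_norm)
qed

section \<open>Projections along a perturbed quarter circle\<close>

lemma proj_span_singleton: "proj (span {y}) x = ((x \<bullet> y) / (y \<bullet> y)) *\<^sub>R y"
proof (rule proj_eqI)
  show "((x \<bullet> y) / (y \<bullet> y)) *\<^sub>R y \<in> span {y}" by (intro span_scale span_base) simp
  show "(x - ((x \<bullet> y) / (y \<bullet> y)) *\<^sub>R y) \<bullet> z = 0" if "z \<in> span {y}" for z
    by (rule orthogonal_span[OF _ that]) (auto simp: inner_diff_left)
qed simp

text \<open>Each of the \<open>k\<close> factors is 1 up to an error of order
  \<open>1 / k^2\<close>, so the total loss of length tends to 0.\<close>

lemma arc_coefficient_tendsto: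
  "(\<lambda>k. 1 / (1 + 1 / real k ^ 2) * (cos (pi / (2 * real k)) / (1 + 1 / real k ^ 2)) ^ k) \<longlonglongrightarrow> 1"
  by real_asymp

text \<open>The \<open>h j\<close> run along a quarter circle from \<open>u\<close> to
  \<open>v\<close>, each lifted by \<open>1 / k\<close> along \<open>g j\<close>. The lifts make
  coordinates in the \<open>h j\<close> readable, which identifies the intersections of initial and
  final spans; the scalar collects the loss of length along the arc.\<close>

lemma arc_transfer_reach:
  fixes u v :: "'a::{real_inner,complete_space}" and g :: "nat \<Rightarrow> 'a"
  assumes uv: "u \<bullet> u = 1" "v \<bullet> v = 1" "u \<bullet> v = 0"
    and g: "\<And>i j. g i \<bullet> g j = (if i = j then 1 else 0)"
    and gu: "\<And>i. g i \<bullet> u = 0" and gv: "\<And>i. g i \<bullet> v = 0"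
    and k: "k > 0"
  obtains V A B where
    "has_proj V" "\<And>q. has_proj (A q)" "\<And>q. has_proj (B q)"
    "V \<subseteq> span ({u, v} \<union> range g)" "\<And>q. A q \<subseteq> span ({u, v} \<union> range g)" "\<And>q. B q \<subseteq> span ({u, v} \<union> range g)"
    "u \<in> V" "v \<in> V"
    "reach (\<lambda>q i. proj (if i = 0 then V else if i = 1 then A q else B q)) {0,1,2::nat} u
      ((1 / (1 + 1 / real k ^ 2) * (cos (pi / (2 * real k)) / (1 + 1 / real k ^ 2)) ^ k) *\<^sub>R (v + (1 / real k) *\<^sub>R g k))"
proof -
  define t where "t = pi / (2 * real k)"
  define h where "h j = cos (real j * t) *\<^sub>R u + sin (real j * t) *\<^sub>R v + (1 / real k) *\<^sub>R g j" for j
  define V where "V = span (h ` {..k} \<union> {u, v})"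
  define M where "M = span ({u, v} \<union> range g)"
  \<comment> \<open>Both chains end with \<open>u\<close> and \<open>v\<close> so that \<open>V\<close> contains them, which the merging of blocks relies on.\<close>
  define hE where "hE i = (if i \<le> k then h i else if i = Suc k then u else v)" for i
  define hF where "hF i = (if i \<le> k then h (k - i) else if i = Suc k then u else v)" for i
  \<comment> \<open>The arc uses up \<open>g 0\<close> to \<open>g k\<close>; the shift leaves an
    orthonormal supply orthogonal to all vectors of both chains.\<close>
  define g' where "g' i = g (i + Suc k)" for i
  have ug: "u \<bullet> g i = 0" "v \<bullet> g i = 0" "v \<bullet> u = 0" for i using gu gv uv by (simp_all add: inner_commute)
  note inn = uv g gu gv ug
  have hM: "h i \<in> M" for i
    unfolding h_def M_def by (intro span_add span_scale span_base) auto
  have uM: "u \<in> M" "v \<in> M" unfolding M_def by (auto intro: span_base)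
  have gM: "g i \<in> M" for i unfolding M_def by (auto intro: span_base)
  have sM: "subspace M" by (simp add: M_def)
  have g'g': "g' i \<bullet> g' j = (if i = j then 1 else 0)" for i j by (simp add: g'_def g)
  have gh: "g i \<bullet> h j = (if i = j then 1 / real k else 0)" for i j
    by (simp add: h_def inner_simps inn)
  have hh: "h i \<bullet> h j = cos (real i * t - real j * t) + (if i = j then 1 / real k ^ 2 else 0)" for i j
    by (simp add: h_def inner_simps inn cos_diff power2_eq_square)
  have g'E: "g' i \<bullet> hE j = 0" and g'F: "g' i \<bullet> hF j = 0" for i j
    by (auto simp: hE_def hF_def g'_def gh gu gv)
  have imE: "hE ` {..Suc (Suc k)} = h ` {..k} \<union> {u, v}"
    by (auto simp: hE_def atMost_Suc)
  have rev: "(\<lambda>i. h (k - i)) ` {..k - j} = h ` {j..k}" if "j \<le> k" for j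
  proof -
    have "h i \<in> (\<lambda>i. h (k - i)) ` {..k - j}" if "i \<in> {j..k}" for i
      by (rule image_eqI[of _ _ "k - i"]) (use that in auto)
    then show ?thesis using that by auto
  qed
  \<comment> \<open>Initial segments of the reversed chain are final segments of the arc, whence the
    index \<open>k - j\<close>.\<close>
  have imF0: "hF ` {..k - j} = h ` {j..k}" if "j \<le> k" for j
  proof -
    have "hF ` {..k - j} = (\<lambda>i. h (k - i)) ` {..k - j}" by (rule image_cong) (auto simp: hF_def)
    then show ?thesis using rev[OF that] by simp
  qed
  have imF: "hF ` {..Suc (Suc k)} = h ` {..k} \<union> {u, v}"
    using imF0[of 0] by (auto simp: hF_def atMost_Suc atLeast0AtMost)
  have imE0: "hE ` {..j} = h ` {..j}" if "j \<le> k" for j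
    by (rule image_cong) (use that in \<open>auto simp: hE_def\<close>)
  obtain A where A: "\<And>q. has_proj (A q)" "\<And>q. A q \<subseteq> span (hE ` {..Suc (Suc k)} \<union> range g')"
    "\<And>j. j \<le> Suc (Suc k) \<Longrightarrow> \<exists>s. \<forall>x\<in>span (hE ` {..Suc (Suc k)}).
       (\<lambda>q. ((\<lambda>y. proj (span (hE ` {..Suc (Suc k)})) (proj (A q) y)) ^^ s q) x) \<longlonglongrightarrow> proj (span (hE ` {..j})) x"
    by (rule chain_approximation[of g' "Suc (Suc k)" hE]) (use g'g' g'E in auto)
  obtain B where B: "\<And>q. has_proj (B q)" "\<And>q. B q \<subseteq> span (hF ` {..Suc (Suc k)} \<union> range g')"
    "\<And>j. j \<le> Suc (Suc k) \<Longrightarrow> \<exists>s. \<forall>x\<in>span (hF ` {..Suc (Suc k)}).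
       (\<lambda>q. ((\<lambda>y. proj (span (hF ` {..Suc (Suc k)})) (proj (B q) y)) ^^ s q) x) \<longlonglongrightarrow> proj (span (hF ` {..j})) x"
    by (rule chain_approximation[of g' "Suc (Suc k)" hF]) (use g'g' g'F in auto)
  have subM: "h ` {..k} \<union> {u, v} \<union> range g' \<subseteq> M"
    using hM uM gM by (auto simp: g'_def)
  have hpV: "has_proj V" unfolding V_def by (simp add: has_proj_span_finite)
  define Q where "Q = (\<lambda>q i. proj (if i = 0 then V else if i = (1::nat) then A q else B q))"
  have contr: "dist (Q q i x) (Q q i y) \<le> dist x y" for q i x y
    unfolding Q_def by (intro proj_contraction) (use hpV A(1) B(1) in auto)
  let ?R = "reach Q {0,1,2}"
  have tr: "?R x z" if "?R x y" "?R y z" for x y z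
    by (rule reach_trans[OF contr that])
  define E where "E j = span (h ` {..j})" for j
  define F where "F j = span (h ` {j..k})" for j
  have hpE: "has_proj (E j)" and hpF: "has_proj (F j)" for j
    by (simp_all add: E_def F_def has_proj_span_finite)
  have EV: "E j \<subseteq> V" and FV: "F j \<subseteq> V" if "j \<le> k" for j
    unfolding E_def F_def V_def by (rule span_mono; use that in auto)+
  have RE: "?R x (proj (E j) x)" if x: "x \<in> V" and j: "j \<le> k" for x j
  proof -
    obtain s where "(\<lambda>q. ((\<lambda>y. proj V (proj (A q) y)) ^^ s q) x) \<longlonglongrightarrow> proj (E j) x"
      using A(3)[of j] x j unfolding imE V_def[symmetric] imE0[OF j] E_def by auto
    then show ?thesis by (intro reach_alternating[where Q = Q and a = 1 and b = 0 and s = s]) (auto simp: Q_def)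
  qed
  have RF: "?R x (proj (F j) x)" if x: "x \<in> V" and j: "j \<le> k" for x j
  proof -
    have "k - j \<le> Suc (Suc k)" by simp
    then obtain s where "(\<lambda>q. ((\<lambda>y. proj V (proj (B q) y)) ^^ s q) x) \<longlonglongrightarrow> proj (F j) x"
      using B(3)[of "k - j"] x j unfolding imF V_def[symmetric] imF0[OF j] F_def by auto
    then show ?thesis by (intro reach_alternating[where Q = Q and a = 2 and b = 0 and s = s]) (auto simp: Q_def)
  qed
  \<comment> \<open>The inner product with \<open>g i\<close> is \<open>1 / k\<close> times the
    coordinate at \<open>h i\<close>; the factor \<open>real k\<close> undoes this.\<close>
  have expand: "x = (\<Sum>i\<le>k. (real k * (g i \<bullet> x)) *\<^sub>R h i)" if "x \<in> E k" for x
    using that unfolding E_def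
  proof (induction rule: span_induct_alt)
    case (step c x y)
    then obtain j where j: "j \<le> k" "x = h j" by auto
    have "(\<Sum>i\<le>k. (real k * (g i \<bullet> h j)) *\<^sub>R h i) = (\<Sum>i\<le>k. if i = j then h j else 0)"
      by (rule sum.cong) (use k in \<open>auto simp: gh\<close>)
    then have "(\<Sum>i\<le>k. (real k * (g i \<bullet> h j)) *\<^sub>R h i) = h j" using j by (simp add: sum.delta)
    moreover have "(\<Sum>i\<le>k. (real k * (g i \<bullet> (c *\<^sub>R h j + y))) *\<^sub>R h i)
      = c *\<^sub>R (\<Sum>i\<le>k. (real k * (g i \<bullet> h j)) *\<^sub>R h i) + (\<Sum>i\<le>k. (real k * (g i \<bullet> y)) *\<^sub>R h i)"
      by (simp add: inner_add_right scaleR_sum_right algebra_simps sum.distrib)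
    ultimately show ?case using step(2)[symmetric] by (simp only: j(2))
  qed simp
  have EF: "E j \<inter> F j = span {h j}" if j: "j \<le> k" for j
  proof
    show "span {h j} \<subseteq> E j \<inter> F j" unfolding E_def F_def
      by (intro Int_greatest span_mono) (use j in auto)
    show "E j \<inter> F j \<subseteq> span {h j}"
    proof
      fix x assume x: "x \<in> E j \<inter> F j"
      have "E j \<subseteq> E k" unfolding E_def by (rule span_mono) (use j in auto)
      then have "x \<in> E k" using x by blast
      \<comment> \<open>Membership in \<open>F j\<close> removes the coordinates below
        \<open>j\<close>, membership in \<open>E j\<close> those above.\<close>
      have "g i \<bullet> x = 0" if "i \<noteq> j" "i \<le> k" for i
      proof (cases "i < j")
        case True
        then show ?thesis
          by (intro orthogonal_span[of "h ` {j..k}" "g i" x]) (use x in \<open>auto simp: gh F_def\<close>)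
      next
        case False
        then show ?thesis
          by (intro orthogonal_span[of "h ` {..j}" "g i" x]) (use x that in \<open>auto simp: gh E_def\<close>)
      qed
      then have "(\<Sum>i\<le>k. (real k * (g i \<bullet> x)) *\<^sub>R h i) = (\<Sum>i\<le>k. if i = j then (real k * (g j \<bullet> x)) *\<^sub>R h j else 0)"
        by (intro sum.cong) auto
      then have "x = (real k * (g j \<bullet> x)) *\<^sub>R h j"
        using expand[OF \<open>x \<in> E k\<close>] j by (simp add: sum.delta)
      then show "x \<in> span {h j}" by (metis span_scale span_base singletonI)
    qed
  qed
  \<comment> \<open>Von Neumann's theorem is applied to \<open>E j\<close> and \<open>F j\<close>;
    the iterates must stay in \<open>V\<close>, where \<open>RE\<close> and \<open>RF\<close> are
    available.\<close>
  have Rh: "?R x (proj (span {h j}) x)" if x: "x \<in> V" and j: "j \<le> k" for x j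
  proof -
    let ?U = "\<lambda>y. proj (E j) (proj (F j) (proj (E j) y))"
    have R0: "?R y y" for y
      by (rule reach_alternating[where Q = Q and a = 0 and b = 0 and s = "\<lambda>_. 0"]) auto
    have "?R x ((?U ^^ n) x) \<and> (?U ^^ n) x \<in> V" for n
    proof (induction n)
      case (Suc n)
      let ?y = "(?U ^^ n) x"
      have "proj (E j) ?y \<in> V" "proj (F j) (proj (E j) ?y) \<in> V" "?U ?y \<in> V"
        using proj_in[OF hpE] proj_in[OF hpF] EV[OF j] FV[OF j] by blast+
      then have "?R ?y (?U ?y)" using Suc RE RF j tr by metis
      then show ?case using Suc tr \<open>?U ?y \<in> V\<close> by auto
    qed (use R0 x in simp)
    then have "?R x ((?U ^^ n) x)" for n by blast
    then have "?R x (proj (E j \<inter> F j) x)"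
      by (rule reach_limit[OF _ von_Neumann_alternating[OF hpE hpF]])
    then show ?thesis unfolding EF[OF j] .
  qed
  define c where "c = 1 / (1 + 1 / real k ^ 2)"
  have hV: "h j \<in> V" if "j \<le> k" for j unfolding V_def using that by (auto intro: span_base)
  have hhj: "h j \<bullet> h j = 1 + 1 / real k ^ 2" for j by (simp add: hh)
  have uV: "u \<in> V" "v \<in> V" by (auto simp: V_def intro: span_base)
  \<comment> \<open>The first projection contributes \<open>c\<close>, as \<open>u\<close> has inner
    product 1 with \<open>h 0\<close>. Each later one contributes \<open>cos t * c\<close>, where
    \<open>c\<close> is the reciprocal of the squared length of every \<open>h j\<close>.\<close>
  have arc: "?R u ((c * (cos t * c) ^ j) *\<^sub>R h j)" if "j \<le> k" for j
    using that
  proof (induction j)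
    case 0
    have "u \<bullet> h 0 = 1" by (simp add: h_def inner_simps inn)
    then show ?case using Rh[of u 0] uV by (simp add: proj_span_singleton hhj c_def)
  next
    case (Suc j)
    let ?y = "(c * (cos t * c) ^ j) *\<^sub>R h j"
    have "?y \<in> V" using hV[of j] Suc.prems by (simp add: V_def span_scale)
    moreover have "h j \<bullet> h (Suc j) = cos t"
    proof -
      have "real j * t - real (Suc j) * t = - t" by (simp add: algebra_simps)
      then show ?thesis by (simp add: hh del: of_nat_Suc)
    qed
    then have "proj (span {h (Suc j)}) ?y = (c * (cos t * c) ^ Suc j) *\<^sub>R h (Suc j)"
      by (simp add: proj_span_singleton hhj c_def)
    ultimately have "?R ?y ((c * (cos t * c) ^ Suc j) *\<^sub>R h (Suc j))"
      using Rh[of ?y "Suc j"] Suc.prems by simp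
    then show ?case using Suc tr by (meson Suc_leD)
  qed
  have "real k * t = pi / 2" using k by (simp add: t_def)
  then have "cos (real k * t) = 0" "sin (real k * t) = 1" by (simp_all only: cos_pi_half sin_pi_half)
  then have "h k = v + (1 / real k) *\<^sub>R g k" by (simp add: h_def)
  then have fin: "?R u ((1 / (1 + 1 / real k ^ 2) * (cos (pi / (2 * real k)) / (1 + 1 / real k ^ 2)) ^ k) *\<^sub>R (v + (1 / real k) *\<^sub>R g k))"
    using arc[of k] by (simp add: c_def t_def)
  show thesis
  proof (rule that[of V A B])
    show "V \<subseteq> span ({u, v} \<union> range g)"
      unfolding V_def M_def[symmetric] by (rule span_minimal) (use subM sM in auto)
    show "A q \<subseteq> span ({u, v} \<union> range g)" for q
      unfolding M_def[symmetric]
      by (rule order_trans[OF A(2)], unfold imE, rule span_minimal) (use subM sM in auto)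
    show "B q \<subseteq> span ({u, v} \<union> range g)" for q
      unfolding M_def[symmetric]
      by (rule order_trans[OF B(2)], unfold imF, rule span_minimal) (use subM sM in auto)
    show "reach (\<lambda>q i. proj (if i = 0 then V else if i = 1 then A q else B q)) {0,1,2::nat} u
      ((1 / (1 + 1 / real k ^ 2) * (cos (pi / (2 * real k)) / (1 + 1 / real k ^ 2)) ^ k) *\<^sub>R (v + (1 / real k) *\<^sub>R g k))"
      using fin unfolding Q_def .
  qed (use hpV A(1) B(1) uV in auto)
qed

text \<open>The number \<open>k\<close> is fixed before \<open>q\<close>: half of \<open>e\<close>
  pays for the end point of the arc, the other half for approximating the projections along
  it.\<close>

lemma arc_transfer:
  fixes u v :: "'a::{real_inner,complete_space}" and g :: "nat \<Rightarrow> 'a"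
  assumes uv: "u \<bullet> u = 1" "v \<bullet> v = 1" "u \<bullet> v = 0"
    and g: "\<And>i j. g i \<bullet> g j = (if i = j then 1 else 0)"
    and gu: "\<And>i. g i \<bullet> u = 0" and gv: "\<And>i. g i \<bullet> v = 0"
    and e: "e > 0"
  shows "\<exists>V A B w. has_proj V \<and> has_proj A \<and> has_proj B \<and>
    V \<subseteq> span ({u, v} \<union> range g) \<and> A \<subseteq> span ({u, v} \<union> range g) \<and> B \<subseteq> span ({u, v} \<union> range g) \<and>
    u \<in> V \<and> v \<in> V \<and> set w \<subseteq> {0,1,2::nat} \<and>
    dist (fold (\<lambda>i. proj (if i = 0 then V else if i = 1 then A else B)) w u) v < e"
proof -
  define c where "c k = 1 / (1 + 1 / real k ^ 2) * (cos (pi / (2 * real k)) / (1 + 1 / real k ^ 2)) ^ k" for k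
  have c: "c \<longlonglongrightarrow> 1" unfolding c_def by (rule arc_coefficient_tendsto)
  have "(\<lambda>k. dist (c k *\<^sub>R (v + (1 / real k) *\<^sub>R g k)) v) \<longlonglongrightarrow> 0"
  proof (rule tendsto_sandwich[of "\<lambda>_. 0" _ _ "\<lambda>k. \<bar>c k - 1\<bar> + \<bar>c k\<bar> * (1 / real k)"])
    have "dist (c k *\<^sub>R (v + (1 / real k) *\<^sub>R g k)) v \<le> \<bar>c k - 1\<bar> + \<bar>c k\<bar> * (1 / real k)" for k
    proof -
      have n: "norm v = 1" "norm (g k) = 1" using uv g by (simp_all add: norm_eq_sqrt_inner)
      have "c k *\<^sub>R (v + (1 / real k) *\<^sub>R g k) - v = (c k - 1) *\<^sub>R v + (c k * (1 / real k)) *\<^sub>R g k"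
        by (simp add: algebra_simps)
      then show ?thesis
        using norm_triangle_ineq[of "(c k - 1) *\<^sub>R v" "(c k * (1 / real k)) *\<^sub>R g k"] n
        by (simp add: dist_norm abs_mult)
    qed
    then show "\<forall>\<^sub>F k in sequentially. dist (c k *\<^sub>R (v + (1 / real k) *\<^sub>R g k)) v \<le> \<bar>c k - 1\<bar> + \<bar>c k\<bar> * (1 / real k)"
      by simp
    have "(\<lambda>k. \<bar>c k - 1\<bar> + \<bar>c k\<bar> * (1 / real k)) \<longlonglongrightarrow> \<bar>1 - 1\<bar> + \<bar>1\<bar> * 0"
      by (intro tendsto_add tendsto_rabs tendsto_diff tendsto_mult tendsto_const c lim_1_over_n)
    then show "(\<lambda>k. \<bar>c k - 1\<bar> + \<bar>c k\<bar> * (1 / real k)) \<longlonglongrightarrow> 0" by simp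
  qed auto
  then have "\<forall>\<^sub>F k in sequentially. dist (c k *\<^sub>R (v + (1 / real k) *\<^sub>R g k)) v < e / 2"
    by (rule order_tendstoD) (use e in auto)
  then have "\<forall>\<^sub>F k in sequentially. k > 0 \<and> dist (c k *\<^sub>R (v + (1 / real k) *\<^sub>R g k)) v < e / 2"
    by (intro eventually_conj eventually_gt_at_top)
  then obtain k where k: "k > 0" "dist (c k *\<^sub>R (v + (1 / real k) *\<^sub>R g k)) v < e / 2"
    by (auto simp: eventually_sequentially)
  obtain V A B where VAB:
    "has_proj V" "\<And>q. has_proj (A q)" "\<And>q. has_proj (B q)"
    "V \<subseteq> span ({u, v} \<union> range g)" "\<And>q. A q \<subseteq> span ({u, v} \<union> range g)" "\<And>q. B q \<subseteq> span ({u, v} \<union> range g)"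
    "u \<in> V" "v \<in> V"
    "reach (\<lambda>q i. proj (if i = 0 then V else if i = 1 then A q else B q)) {0,1,2::nat} u
      (c k *\<^sub>R (v + (1 / real k) *\<^sub>R g k))"
    unfolding c_def by (rule arc_transfer_reach[OF uv g gu gv k(1)]) blast
  from e have "e / 2 > 0" by simp
  from VAB(9)[unfolded reach_def, rule_format, OF this] have "\<forall>\<^sub>F q in sequentially. \<exists>w. set w \<subseteq> {0,1,2::nat} \<and>
      dist (fold (\<lambda>i. proj (if i = 0 then V else if i = 1 then A q else B q)) w u)
        (c k *\<^sub>R (v + (1 / real k) *\<^sub>R g k)) < e / 2"
    .
  from eventually_happens'[OF sequentially_bot this] obtain q w where w: "set w \<subseteq> {0,1,2::nat}"
      "dist (fold (\<lambda>i. proj (if i = 0 then V else if i = 1 then A q else B q)) w u)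
        (c k *\<^sub>R (v + (1 / real k) *\<^sub>R g k)) < e / 2"
    by blast
  have "dist (fold (\<lambda>i. proj (if i = 0 then V else if i = 1 then A q else B q)) w u) v < e"
    using w(2) k(2) dist_triangle[of "fold (\<lambda>i. proj (if i = 0 then V else if i = 1 then A q else B q)) w u" v
      "c k *\<^sub>R (v + (1 / real k) *\<^sub>R g k)"] by linarith
  then show ?thesis using VAB(1-8) w(1)
    by (intro exI[of _ V] exI[of _ "A q"] exI[of _ "B q"] exI[of _ w] conjI)
qed

section \<open>Merging the blocks\<close>

lemma orthogonal_closure_span:
  fixes x :: "'a::real_inner"
  assumes "\<And>y. y \<in> B \<Longrightarrow> x \<bullet> y = 0" "z \<in> closure (span B)"
  shows "x \<bullet> z = 0"
proof -
  have "closed {z. x \<bullet> z = 0}" by (intro closed_Collect_eq continuous_intros)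
  moreover have "span B \<subseteq> {z. x \<bullet> z = 0}" using orthogonal_span[OF assms(1)] by auto
  ultimately have "closure (span B) \<subseteq> {z. x \<bullet> z = 0}" by (rule closure_minimal[rotated])
  then show ?thesis using assms(2) by auto
qed

lemma subspace_closure:
  fixes S :: "'a::real_normed_vector set"
  assumes "subspace S"
  shows "subspace (closure S)"
proof (rule subspaceI)
  show "0 \<in> closure S" using subspace_0[OF assms] closure_subset by blast
  show "x + y \<in> closure S" if "x \<in> closure S" "y \<in> closure S" for x y
  proof -
    from that obtain f g where "\<forall>n. f n \<in> S" "f \<longlonglongrightarrow> x" "\<forall>n. g n \<in> S" "g \<longlonglongrightarrow> y"
      unfolding closure_sequential by blast
    then show ?thesis
      unfolding closure_sequential
      by (intro exI[of _ "\<lambda>n. f n + g n"]) (auto intro: tendsto_add subspace_add[OF assms])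
  qed
  show "c *\<^sub>R x \<in> closure S" if "x \<in> closure S" for c x
  proof -
    from that obtain f where "\<forall>n. f n \<in> S" "f \<longlonglongrightarrow> x"
      unfolding closure_sequential by blast
    then show ?thesis
      unfolding closure_sequential
      by (intro exI[of _ "\<lambda>n. c *\<^sub>R f n"]) (auto intro: tendsto_scaleR subspace_scale[OF assms])
  qed
qed

lemma has_proj_closure_span:
  fixes B :: "'a::{real_inner,complete_space} set"
  shows "has_proj (closure (span B))"
  by (intro has_proj_closed_subspace subspace_closure subspace_span) simp

text \<open>Only the residual of the given \<open>x\<close> has to be orthogonal to the other
  members. This covers the subspaces \<open>V n\<close> below, which are not mutually
  orthogonal.\<close>

lemma proj_closure_span_Union:
  assumes k: "k \<in> I" and T: "has_proj (T k)"
    and orth: "\<And>m y. m \<in> I \<Longrightarrow> m \<noteq> k \<Longrightarrow> y \<in> T m \<Longrightarrow> (x - proj (T k) x) \<bullet> y = 0"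
  shows "proj (closure (span (\<Union>n\<in>I. T n))) x = proj (T k) x"
proof (rule proj_eqI)
  show "subspace (closure (span (\<Union>n\<in>I. T n)))" by (intro subspace_closure subspace_span)
  show "proj (T k) x \<in> closure (span (\<Union>n\<in>I. T n))"
    using proj_in[OF T] k by (intro closure_subset[THEN subsetD] span_base) auto
  show "(x - proj (T k) x) \<bullet> z = 0" if "z \<in> closure (span (\<Union>n\<in>I. T n))" for z
    by (rule orthogonal_closure_span[OF _ that]) (use orth proj_orth[OF T] in blast)
qed

text \<open>Contractions do not enlarge earlier errors, so the orbit comes within 1/4 of every
  \<open>e N\<close>, while consecutive \<open>e N\<close> are at distance at least 1.\<close>

lemma divergent_concatenation:
  fixes Q :: "'i \<Rightarrow> 'a::metric_space \<Rightarrow> 'a"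
  assumes contr: "\<And>i x y. i \<in> I \<Longrightarrow> dist (Q i x) (Q i y) \<le> dist x y"
    and WI: "\<And>n. set (W n) \<subseteq> I"
    and W: "\<And>n. dist (fold Q (W n) (e n)) (e (Suc n)) < (1/8) * (1/2) ^ n"
    and sep: "\<And>n. dist (e n) (e (Suc n)) \<ge> 1"
  obtains \<sigma> where "\<And>n::nat. \<sigma> n \<in> I"
    "\<not> convergent (\<lambda>n. product_operator (\<lambda>n. Q (\<sigma> n)) (Suc n) (e 0))"
proof -
  define C where "C N = concat (map W [0..<N])" for N
  have C_Suc: "C (Suc N) = C N @ W N" for N by (simp add: C_def)
  have C0: "C 0 = []" by (simp add: C_def)
  \<comment> \<open>An empty word would put \<open>e n\<close> close to \<open>e (Suc n)\<close>.
    Nonempty words make the concatenations grow, so the infinite word is defined at every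
    position.\<close>
  have ne: "W n \<noteq> []" for n
  proof
    assume "W n = []"
    then have "1 < (1/8) * (1/2 :: real) ^ n" using W[of n] sep[of n] by simp
    moreover have "(1/2 :: real) ^ n \<le> 1" by (simp add: power_le_one)
    ultimately show False by simp
  qed
  have len: "length (C N) < length (C (Suc N))" for N using ne[of N] by (simp add: C_Suc)
  then have sm: "strict_mono (\<lambda>N. length (C N))" by (simp add: strict_mono_Suc_iff)
  have lenge: "N \<le> length (C N)" for N using strict_mono_imp_increasing[OF sm] .
  have prefix: "\<exists>R. C (N + d) = C N @ R" for N d
    by (induction d) (auto simp: C_Suc)
  have nth: "C N ! i = C M ! i" if "i < length (C N)" "i < length (C M)" for N M i
  proof -
    have "C N ! i = C (N + M) ! i" using prefix[of N M] that by (auto simp: nth_append)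
    moreover have "C M ! i = C (N + M) ! i" using prefix[of M N] that by (auto simp: nth_append add.commute)
    ultimately show ?thesis by simp
  qed
  have CI: "set (C N) \<subseteq> I" for N using WI by (auto simp: C_def)
  \<comment> \<open>The product starts with index 1, which is letter 0 of the list; the value at 0
    is a dummy that still lies in \<open>I\<close>.\<close>
  define \<sigma> where "\<sigma> n = C (Suc n) ! (n - 1)" for n
  have bound: "n - 1 < length (C (Suc n))" for n using lenge[of "Suc n"] by simp
  have \<sigma>I: "\<sigma> n \<in> I" for n unfolding \<sigma>_def using nth_mem[OF bound] CI by blast
  define p where "p n = product_operator (\<lambda>n. Q (\<sigma> n)) n (e 0)" for n
  have p: "p l = fold Q (take l (C N)) (e 0)" if "l \<le> length (C N)" for l N
    using that
  proof (induction l)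
    case (Suc l)
    have "\<sigma> (Suc l) = C N ! l"
      unfolding \<sigma>_def using nth[of l "Suc (Suc l)" N] Suc.prems bound[of "Suc l"] by simp
    then show ?case using Suc by (simp add: p_def take_Suc_conv_app_nth)
  qed (simp add: p_def)
  have y: "p (length (C N)) = fold Q (C N) (e 0)" for N using p[of "length (C N)" N] by simp
  \<comment> \<open>The bound is the sum of \<open>(1/8) * (1/2) ^ n\<close> over
    \<open>n < N\<close>.\<close>
  have near: "dist (p (length (C N))) (e N) \<le> 1/4 * (1 - (1/2) ^ N)" for N
    unfolding y
  proof (induction N)
    case (Suc N)
    have "dist (fold Q (W N) (fold Q (C N) (e 0))) (fold Q (W N) (e N)) \<le> dist (fold Q (C N) (e 0)) (e N)"
      by (rule fold_contraction[OF contr WI])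
    then have "dist (fold Q (C (Suc N)) (e 0)) (e (Suc N)) \<le> 1/4 * (1 - (1/2) ^ N) + (1/8) * (1/2) ^ N"
      using dist_triangle[of "fold Q (C (Suc N)) (e 0)" "e (Suc N)" "fold Q (W N) (e N)"] Suc.IH W[of N]
      by (simp only: C_Suc fold_append o_apply)
    then show ?case by (simp add: algebra_simps)
  qed (simp add: C0)
  have near': "dist (p (length (C N))) (e N) \<le> 1/4" for N
  proof -
    have "1/4 * (1 - r) \<le> 1/4" if "0 \<le> r" for r :: real using that by simp
    then show ?thesis by (rule order_trans[OF near]) simp
  qed
  show thesis
  proof (rule that[of \<sigma>])
    show "\<not> convergent (\<lambda>n. product_operator (\<lambda>n. Q (\<sigma> n)) (Suc n) (e 0))"
    proof
      assume "convergent (\<lambda>n. product_operator (\<lambda>n. Q (\<sigma> n)) (Suc n) (e 0))"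
      then obtain l where "(\<lambda>n. p (Suc n)) \<longlonglongrightarrow> l" unfolding p_def convergent_def by blast
      then have "p \<longlonglongrightarrow> l" by (rule LIMSEQ_imp_Suc)
      then have "(\<lambda>N. p (length (C N))) \<longlonglongrightarrow> l"
        using LIMSEQ_subseq_LIMSEQ[OF _ sm] by (auto simp: o_def)
      then obtain N where N: "\<And>n. n \<ge> N \<Longrightarrow> dist (p (length (C n))) l < 1/8"
        unfolding lim_sequentially by (meson zero_less_divide_1_iff zero_less_numeral)
      \<comment> \<open>The distances 1/4, 1/8, 1/8 and 1/4 would join \<open>e N\<close> to
        \<open>e (Suc N)\<close>, but they add up to less than 1.\<close>
      show False
        using N[of N, OF order_refl] N[of "Suc N", OF le_SucI[OF order_refl]] near'[of N] near'[of "Suc N"] sep[of N]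
          dist_triangle[of "e N" "e (Suc N)" l]
          dist_triangle3[of "e N" l "p (length (C N))"]
          dist_triangle3[of l "e (Suc N)" "p (length (C (Suc N)))"]
        by linarith
    qed
  qed (rule \<sigma>I)
qed

lemma five_subspaces_divergent:
  fixes b :: "nat \<Rightarrow> 'a::{real_inner,complete_space}"
  assumes on: "\<And>i j. b i \<bullet> b j = (if i = j then 1 else 0)"
  obtains S :: "nat \<Rightarrow> 'a set" and \<sigma> :: "nat \<Rightarrow> nat" and x where
    "\<And>i. has_proj (S i)" "\<And>i. S i \<subseteq> closure (span (range b))" "x \<in> closure (span (range b))"
    "\<And>n. \<sigma> n \<in> {1..5}"
    "\<not> convergent (\<lambda>n. product_operator (\<lambda>n. proj (S (\<sigma> n))) (Suc n) x)"
proof -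
  \<comment> \<open>The pairing function splits \<open>b\<close> into row 0 for the
    \<open>e n\<close> and row \<open>Suc n\<close> for the private directions of block
    \<open>n\<close>.\<close>
  define e where "e n = b (prod_encode (0, n))" for n
  define g where "g n i = b (prod_encode (Suc n, i))" for n i
  have prod_inj: "prod_encode p = prod_encode q \<longleftrightarrow> p = q" for p q by (rule prod_encode_eq)
  have ee: "e i \<bullet> e j = (if i = j then 1 else 0)"
    and eg: "e i \<bullet> g n j = 0" and ge: "g n j \<bullet> e i = 0"
    and gg: "g n i \<bullet> g m j = (if n = m \<and> i = j then 1 else 0)" for i j n m
    by (simp_all add: e_def g_def on prod_inj)
  define M where "M n = span ({e n, e (Suc n)} \<union> range (g n))" for n
  define block where "block V A B i = proj (if i = 0 then V else if i = (1::nat) then A else B)" for V A B :: "'a set" and i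
  define G where "G n V A B w \<longleftrightarrow> has_proj V \<and> has_proj A \<and> has_proj B \<and>
    V \<subseteq> M n \<and> A \<subseteq> M n \<and> B \<subseteq> M n \<and> e n \<in> V \<and> e (Suc n) \<in> V \<and> set w \<subseteq> {0,1,2::nat} \<and>
    dist (fold (block V A B) w (e n)) (e (Suc n)) < (1/8) * (1/2) ^ n" for n V A B w
  have "\<exists>V A B w. G n V A B w" for n
    unfolding G_def M_def block_def
    by (rule arc_transfer) (simp_all add: ee gg ge)
  then obtain V A B w where "\<And>n. G n (V n) (A n) (B n) (w n)" by metis
  then have hV: "has_proj (V n)" and hA: "has_proj (A n)" and hB: "has_proj (B n)"
    and VM: "V n \<subseteq> M n" and AM: "A n \<subseteq> M n" and BM: "B n \<subseteq> M n"
    and eV: "e n \<in> V n" "e (Suc n) \<in> V n" and w: "set (w n) \<subseteq> {0,1,2}"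
    and close: "dist (fold (block (V n) (A n) (B n)) (w n) (e n)) (e (Suc n)) < (1/8) * (1/2) ^ n" for n
    unfolding G_def by blast+
  have sM: "subspace (M n)" for n by (simp add: M_def)
  have Me: "z \<bullet> e j = 0" if "z \<in> M n" "j \<noteq> n" "j \<noteq> Suc n" for z n j
  proof -
    have "e j \<bullet> z = 0"
      using that(1) unfolding M_def by (rule orthogonal_span[rotated]) (use that in \<open>auto simp: ee eg\<close>)
    then show ?thesis by (simp add: inner_commute)
  qed
  have Mg: "z \<bullet> g m i = 0" if "z \<in> M n" "m \<noteq> n" for z n m i
  proof -
    have "g m i \<bullet> z = 0"
      using that(1) unfolding M_def by (rule orthogonal_span[rotated]) (use that in \<open>auto simp: gg ge\<close>)
    then show ?thesis by (simp add: inner_commute)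
  qed
  \<comment> \<open>Blocks can share only vectors \<open>e j\<close>, so a vector of block
    \<open>n\<close> orthogonal to \<open>e n\<close> and \<open>e (Suc n)\<close> is orthogonal to
    all other blocks.\<close>
  have orthM: "z \<bullet> y = 0"
    if "z \<in> M n" "y \<in> M m" "m \<noteq> n" "z \<bullet> e n = 0" "z \<bullet> e (Suc n) = 0" for z y n m
  proof -
    have "z \<bullet> e j = 0" for j using Me[OF that(1), of j] that(4,5) by fastforce
    then show ?thesis
      using that(2) unfolding M_def by (rule_tac orthogonal_span[rotated]) (use Mg[OF that(1,3)] in auto)
  qed
  \<comment> \<open>Distinct blocks of equal parity share no \<open>e j\<close>.\<close>
  have farM: "z \<bullet> y = 0"
    if "z \<in> M n" "y \<in> M m" "m \<noteq> n" "even m = even n" for z y n m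
  proof -
    have "m \<noteq> Suc n" "n \<noteq> Suc m" using that(4) by auto
    then show ?thesis
      using that(2) unfolding M_def
      by (rule_tac orthogonal_span[rotated]) (use Mg[OF that(1,3)] Me[OF that(1)] that(3) in auto)
  qed
  define par where "par k = {n::nat. even n = k}" for k
  \<comment> \<open>Letters 0, 1, 2 of block \<open>n\<close> become 1, 2, 3 for even \<open>n\<close> and 1, 4, 5 for odd \<open>n\<close>.\<close>
  define S where "S i = closure (span (if i = (1::nat) then \<Union>n\<in>UNIV. V n else if i = 2 then \<Union>n\<in>par True. A n
    else if i = 3 then \<Union>n\<in>par True. B n else if i = 4 then \<Union>n\<in>par False. A n else \<Union>n\<in>par False. B n))" for i
  define lett where "lett n i = (if i = 0 then 1 else if even n then i + 1 else i + 3)" for n i :: nat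
  have hS: "has_proj (S i)" for i unfolding S_def by (rule has_proj_closure_span)
  have agree: "proj (S (lett n i)) x = block (V n) (A n) (B n) i x"
    "block (V n) (A n) (B n) i x \<in> M n" if x: "x \<in> M n" and i: "i \<in> {0,1,2}" for n i x
  proof -
    show "block (V n) (A n) (B n) i x \<in> M n"
      using subsetD[OF VM proj_in[OF hV]] subsetD[OF AM proj_in[OF hA]] subsetD[OF BM proj_in[OF hB]]
      by (simp add: block_def)
    have res: "x - proj T x \<in> M n" if "has_proj T" "T \<subseteq> M n" for T
      using x proj_in[OF that(1)] that(2) sM by (intro subspace_diff) auto
    \<comment> \<open>Since \<open>V n\<close> contains \<open>e n\<close> and
      \<open>e (Suc n)\<close>, the residual is orthogonal to both, and even neighbouring blocks do
      not interfere.\<close>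
    have pV: "proj (closure (span (\<Union>n\<in>UNIV. V n))) x = proj (V n) x"
    proof (rule proj_closure_span_Union)
      fix m y assume m: "m \<noteq> n" "y \<in> V m"
      show "(x - proj (V n) x) \<bullet> y = 0"
        by (rule orthM[OF res[OF hV VM], where m = m]) (use m(1) subsetD[OF VM m(2)] proj_orth[OF hV] eV in simp_all)
    qed (simp_all add: hV)
    have pA: "proj (closure (span (\<Union>n\<in>par (even n). A n))) x = proj (A n) x"
    proof (rule proj_closure_span_Union)
      fix m y assume m: "m \<in> par (even n)" "m \<noteq> n" "y \<in> A m"
      show "(x - proj (A n) x) \<bullet> y = 0"
        by (rule farM[OF res[OF hA AM], where m = m]) (use m subsetD[OF AM m(3)] in \<open>simp_all add: par_def\<close>)
    qed (simp_all add: hA par_def)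
    have pB: "proj (closure (span (\<Union>n\<in>par (even n). B n))) x = proj (B n) x"
    proof (rule proj_closure_span_Union)
      fix m y assume m: "m \<in> par (even n)" "m \<noteq> n" "y \<in> B m"
      show "(x - proj (B n) x) \<bullet> y = 0"
        by (rule farM[OF res[OF hB BM], where m = m]) (use m subsetD[OF BM m(3)] in \<open>simp_all add: par_def\<close>)
    qed (simp_all add: hB par_def)
    show "proj (S (lett n i)) x = block (V n) (A n) (B n) i x"
    proof (cases "even n")
      case True
      with i pV pA pB show ?thesis
        by (elim insertE emptyE; hypsubst; simp add: S_def lett_def block_def)
    next
      case False
      with i pV pA pB show ?thesis
        by (elim insertE emptyE; hypsubst; simp add: S_def lett_def block_def)
    qed
  qed
  define Q where "Q i = proj (S i)" for i
  have agree_fold: "fold Q (map (lett n) v) x = fold (block (V n) (A n) (B n)) v x"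
    if "x \<in> M n" "set v \<subseteq> {0,1,2}" for n v x
    using that by (induction v arbitrary: x) (simp_all add: Q_def agree)
  have eM: "e n \<in> M n" for n using eV(1) VM by blast
  have sep: "dist (e n) (e (Suc n)) \<ge> 1" for n
  proof -
    have "dist (e n) (e (Suc n)) ^ 2 = 2"
      by (simp add: dist_norm power2_norm_eq_inner inner_diff_left inner_diff_right ee)
    then show ?thesis by (rule_tac power2_le_imp_le) auto
  qed
  obtain \<sigma> where \<sigma>: "\<And>n::nat. \<sigma> n \<in> {1..5::nat}"
    "\<not> convergent (\<lambda>n. product_operator (\<lambda>n. Q (\<sigma> n)) (Suc n) (e 0))"
  proof (rule divergent_concatenation[of "{1..5::nat}" Q "\<lambda>n. map (lett n) (w n)" e])
    show "dist (Q i x) (Q i y) \<le> dist x y" for i x y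
      unfolding Q_def by (rule proj_contraction[OF hS])
    show "set (map (lett n) (w n)) \<subseteq> {1..5}" for n
      using w[of n] by (auto simp: lett_def)
    show "dist (fold Q (map (lett n) (w n)) (e n)) (e (Suc n)) < (1/8) * (1/2) ^ n" for n
      using agree_fold[OF eM w] close by simp
  qed (rule sep, rule that)
  have eb: "e n \<in> span (range b)" and gb: "g n i \<in> span (range b)" for n i
    by (auto simp: e_def g_def intro: span_base)
  have Mb: "M n \<subseteq> span (range b)" for n
    unfolding M_def by (rule span_minimal) (use eb gb in auto)
  show thesis
  proof (rule that[of S "e 0" \<sigma>])
    show "S i \<subseteq> closure (span (range b))" for i
      unfolding S_def
      by (intro closure_mono span_minimal subspace_span)
        (simp add: UN_least order_trans[OF VM Mb] order_trans[OF AM Mb] order_trans[OF BM Mb])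
    show "e 0 \<in> closure (span (range b))" using eb closure_subset by blast
  qed (use hS \<sigma> in \<open>auto simp: Q_def\<close>)
qed

text \<open>Unit vectors are chosen one after another, orthogonal to finitely many earlier vectors.
  The sets \<open>K x\<close> allow for companions: in the complex case also the multiple of
  \<open>x\<close> by \<open>\<i>\<close>, which gives orthogonality for the complex inner
  product.\<close>

lemma orthonormal_sequence:
  fixes K :: "'a::real_inner \<Rightarrow> 'a set"
  assumes inf: "\<And>B::'a set. finite B \<Longrightarrow> span B \<noteq> UNIV" and K: "\<And>x. finite (K x)"
  obtains b :: "nat \<Rightarrow> 'a" where "\<And>n. b n \<bullet> b n = 1" "\<And>m n y. m < n \<Longrightarrow> y \<in> K (b m) \<Longrightarrow> b n \<bullet> y = 0"
proof -
  have "\<exists>x. x \<bullet> x = 1 \<and> (\<forall>y\<in>B. x \<bullet> y = 0)" if B: "finite B" for B :: "'a set"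
  proof -
    obtain x0 where x0: "x0 \<notin> span B" using inf[OF B] by blast
    define z where "z = x0 - proj (span B) x0"
    have hp: "has_proj (span B)" by (rule has_proj_span_finite[OF B])
    have "z \<noteq> 0" using x0 proj_in[OF hp, of x0] by (auto simp: z_def)
    moreover have "z \<bullet> y = 0" if "y \<in> B" for y
      unfolding z_def by (rule proj_orth[OF hp span_base[OF that]])
    ultimately show ?thesis
      by (intro exI[of _ "(1 / norm z) *\<^sub>R z"]) (auto simp: dot_square_norm power2_eq_square)
  qed
  then obtain N where N: "\<And>B::'a set. finite B \<Longrightarrow> N B \<bullet> N B = 1" "\<And>(B::'a set) y. finite B \<Longrightarrow> y \<in> B \<Longrightarrow> N B \<bullet> y = 0"
    by metis
  define T where "T n = rec_nat {} (\<lambda>_ B. B \<union> K (N B)) n" for n :: nat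
  have T_Suc: "T (Suc n) = T n \<union> K (N (T n))" and T0: "T 0 = {}" for n by (simp_all add: T_def)
  have fT: "finite (T n)" for n by (induction n) (simp_all add: T_Suc T0 K)
  have "T m \<subseteq> T n" if "m \<le> n" for m n using that by (rule lift_Suc_mono_le[rotated]) (auto simp: T_Suc)
  then have "K (N (T m)) \<subseteq> T n" if "m < n" for m n
    using that T_Suc[of m] by (metis Suc_leI le_sup_iff)
  then show thesis using N fT by (intro that[of "\<lambda>n. N (T n)"]) blast+
qed

section \<open>Complex Hilbert spaces\<close>

text \<open>The complex structure is handled as a real-linear isometry squaring to minus the
  identity, so that the real results apply.\<close>

abbreviation (input) J :: "'a::complex_inner \<Rightarrow> 'a"
  where "J x \<equiv> \<i> *\<^sub>C x"

lemma scaleC_Re_Im: "c *\<^sub>C x = Re c *\<^sub>R x + Im c *\<^sub>R J x"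
proof -
  have "c *\<^sub>C x = (complex_of_real (Re c) + complex_of_real (Im c) * \<i>) *\<^sub>C x"
    using complex_eq[of c] by (simp add: mult.commute)
  then show ?thesis by (simp only: scaleC_add_left scaleC_scaleC[symmetric] scaleC_complex_of_real)
qed

lemma J_J: "J (J x) = - x"
  using scaleC_complex_of_real[of "-1" x] by (simp add: scaleC_scaleC)

lemma Im_cinner: "Im (cinner x y) = J x \<bullet> y"
  by (simp add: inner_eq_Re_cinner cinner_scaleC_left)

lemma inner_J_left: "J x \<bullet> y = - (x \<bullet> J y)"
proof -
  have "x \<bullet> J y = J y \<bullet> x" by (rule inner_commute)
  also have "\<dots> = Im (cinner y x)" by (rule Im_cinner[symmetric])
  also have "\<dots> = - Im (cinner x y)" using cinner_commute[of y x] by simp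
  finally show ?thesis by (simp add: Im_cinner)
qed

lemma inner_J_self: "x \<bullet> J x = 0"
  using inner_J_left[of x x] by (simp add: inner_commute)

lemma inner_J_J: "J x \<bullet> J y = x \<bullet> y"
  by (simp add: inner_J_left J_J)

lemma J_scaleR: "J (r *\<^sub>R x) = r *\<^sub>R J x"
  by (simp add: scaleC_scaleC mult.commute flip: scaleC_complex_of_real)

text \<open>Invariance of \<open>S\<close> makes the real projection commute with \<open>J\<close>;
  complex linearity and self-adjointness for \<open>cinner\<close> follow.\<close>

lemma complex_orthogonal_projection_proj:
  fixes S :: "'a::complex_inner set"
  assumes S: "has_proj S" and JS: "\<And>x. x \<in> S \<Longrightarrow> J x \<in> S"
  shows "complex_orthogonal_projection (proj S)"
proof -
  have sub: "subspace S" by (rule has_proj_subspace[OF S])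
  have "c *\<^sub>C x \<in> S" if "x \<in> S" for c x
    by (subst scaleC_Re_Im) (intro subspace_add subspace_scale sub that JS)
  then have csub: "complex_vector.subspace S"
    using sub by (auto simp: complex_vector.subspace_def subspace_0 subspace_add)
  have op: "orthogonal_projection (proj S)" by (rule orthogonal_projection_proj[OF S])
  then have lin: "linear (proj S)" and sa: "proj S x \<bullet> y = x \<bullet> proj S y"
    and idem: "proj S (proj S x) = proj S x" for x y
    unfolding orthogonal_projection_def by (simp_all add: bounded_linear.linear)
  have ran: "closed S \<and> range (proj S) = S"
    using has_proj_closed[OF S] range_proj[OF S] by blast
  have PJ: "proj S (J x) = J (proj S x)" for x
  proof (rule proj_eqI[OF sub JS[OF proj_in[OF S]]])
    fix z assume "z \<in> S"
    then have "(x - proj S x) \<bullet> J z = 0" by (intro proj_orth[OF S] JS)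
    then show "(J x - J (proj S x)) \<bullet> z = 0"
      by (simp add: complex_vector.scale_right_diff_distrib[symmetric] inner_J_left)
  qed
  have "proj S (c *\<^sub>C x) = c *\<^sub>C proj S x" for c x
    by (simp add: scaleC_Re_Im[of c x] scaleC_Re_Im[of c "proj S x"] linear_add[OF lin]
      linear_scale[OF lin] PJ)
  then have "Vector_Spaces.linear (*\<^sub>C) (*\<^sub>C) (proj S)"
    by (simp add: Vector_Spaces.linear_iff complex_vector.vector_space_axioms linear_add[OF lin])
  moreover have "cinner (proj S x) y = cinner x (proj S y)" for x y
    by (rule complex_eqI) (simp_all add: Im_cinner inner_eq_Re_cinner[symmetric] sa flip: PJ)
  ultimately show ?thesis
    using op csub idem ran unfolding complex_orthogonal_projection_def orthogonal_projection_def by blast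
qed

text \<open>\<open>T\<close> is the orthogonal sum of \<open>S\<close> and its image under
  \<open>J\<close>. A vector orthogonal to that image has no component there, so complexification
  does not change its projection.\<close>

lemma proj_complexification:
  fixes S :: "'a::complex_inner set"
  assumes S: "has_proj S" and orth: "\<And>x y. x \<in> S \<Longrightarrow> y \<in> S \<Longrightarrow> x \<bullet> J y = 0"
  defines "T \<equiv> {a + J c |a c. a \<in> S \<and> c \<in> S}"
  shows "has_proj T" and "x \<in> T \<Longrightarrow> J x \<in> T"
    and "(\<And>y. y \<in> S \<Longrightarrow> z \<bullet> J y = 0) \<Longrightarrow> proj T z = proj S z"
proof -
  have sub: "subspace S" by (rule has_proj_subspace[OF S])
  note pin = proj_in[OF S] and po = proj_orth[OF S]
  have TI: "a + J c \<in> T" if "a \<in> S" "c \<in> S" for a c using that unfolding T_def by blast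
  show JT: "J x \<in> T" if "x \<in> T" for x
  proof -
    from that obtain a c where ac: "a \<in> S" "c \<in> S" "x = a + J c" unfolding T_def by blast
    then have "J x = - c + J a" by (simp add: scaleC_add_right J_J)
    then show ?thesis using TI[of "- c" a] ac subspace_neg[OF sub] by simp
  qed
  have subT: "subspace T"
  proof (rule subspaceI)
    show "0 \<in> T" using TI[of 0 0] subspace_0[OF sub] by simp
    show "x + y \<in> T" if xy: "x \<in> T" "y \<in> T" for x y
    proof -
      from xy obtain a c a' c' where s: "a \<in> S" "c \<in> S" "x = a + J c" "a' \<in> S" "c' \<in> S" "y = a' + J c'"
        unfolding T_def by blast
      then have "x + y = (a + a') + J (c + c')" by (simp add: scaleC_add_right)
      then show ?thesis using TI[of "a + a'" "c + c'"] s subspace_add[OF sub] by metis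
    qed
    show "r *\<^sub>R x \<in> T" if x: "x \<in> T" for r x
    proof -
      from x obtain a c where s: "a \<in> S" "c \<in> S" "x = a + J c" unfolding T_def by blast
      then have "r *\<^sub>R x = r *\<^sub>R a + J (r *\<^sub>R c)" by (simp add: scaleR_add_right J_scaleR)
      then show ?thesis using TI[of "r *\<^sub>R a" "r *\<^sub>R c"] s subspace_scale[OF sub] by simp
    qed
  qed
  have "\<exists>y\<in>T. \<forall>w\<in>T. (x - y) \<bullet> w = 0" for x
  proof (intro bexI ballI)
    \<comment> \<open>The projection onto the image of \<open>S\<close> under \<open>J\<close> is
      \<open>proj S\<close> conjugated by \<open>J\<close>; the sign comes from the inverse of
      \<open>J\<close> being \<open>- J\<close>.\<close>
    let ?y = "proj S x + J (- proj S (J x))"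
    show "?y \<in> T" using TI pin subspace_neg[OF sub] by blast
    fix w assume "w \<in> T"
    then obtain a c where s: "a \<in> S" "c \<in> S" "w = a + J c" unfolding T_def by blast
    have 1: "x \<bullet> a = proj S x \<bullet> a" "J x \<bullet> c = proj S (J x) \<bullet> c"
      using po[OF s(1), of x] po[OF s(2), of "J x"] by (simp_all add: inner_diff_left)
    have 2: "x \<bullet> J c = - (J x \<bullet> c)" "proj S x \<bullet> J c = 0" "J (proj S (J x)) \<bullet> a = 0"
      using orth[OF pin s(2)] orth[OF pin s(1)] by (simp_all add: inner_J_left)
    have "x \<bullet> w = proj S x \<bullet> a - proj S (J x) \<bullet> c" using 1 2 s(3) by (simp add: inner_add_right)
    moreover have "?y \<bullet> w = proj S x \<bullet> a - proj S (J x) \<bullet> c"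
      using 2 s(3) by (simp add: inner_add_right inner_add_left inner_diff_left inner_J_J)
    ultimately show "(x - ?y) \<bullet> w = 0" by (simp only: inner_diff_left)
  qed
  then show "has_proj T" unfolding has_proj_def using subT by blast
  show "proj T z = proj S z" if z: "\<And>y. y \<in> S \<Longrightarrow> z \<bullet> J y = 0"
  proof (rule proj_eqI[OF subT])
    show "proj S z \<in> T" using TI[OF pin subspace_0[OF sub]] by simp
    fix w assume "w \<in> T"
    then obtain a c where s: "a \<in> S" "c \<in> S" "w = a + J c" unfolding T_def by blast
    then show "(z - proj S z) \<bullet> w = 0"
      using po[OF s(1), of z] z[OF s(2)] orth[OF pin[of z] s(2)]
      by (simp add: inner_add_right inner_diff_left)
  qed
qed

section \<open>The real and the complex statement\<close>

lemma real_divergent: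
  assumes "\<not> (\<exists>B::'a::{real_inner,complete_space} set. finite B \<and> span B = UNIV)"
  shows "\<exists>(x::'a) (Q::nat \<Rightarrow> 'a \<Rightarrow> 'a) (P::nat \<Rightarrow> 'a \<Rightarrow> 'a).
        (\<forall>i\<in>{1..5}. orthogonal_projection (Q i)) \<and>
        (\<forall>n\<ge>1. P n \<in> Q ` {1..5}) \<and>
        \<not> convergent (\<lambda>n. product_operator P (Suc n) x)"
proof -
  obtain b :: "nat \<Rightarrow> 'a" where b: "\<And>n. b n \<bullet> b n = 1" "\<And>m n y. m < n \<Longrightarrow> y \<in> {b m} \<Longrightarrow> b n \<bullet> y = 0"
  proof (rule orthonormal_sequence[of "\<lambda>x::'a. {x}"])
    show "span B \<noteq> UNIV" if "finite B" for B :: "'a set" using assms that by blast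
  qed blast+
  have "b i \<bullet> b j = (if i = j then 1 else 0)" for i j
    using b(1)[of i] b(2)[of i j "b i"] b(2)[of j i "b j"] by (cases i j rule: linorder_cases) (auto simp: inner_commute)
  then obtain S and \<sigma> :: "nat \<Rightarrow> nat" and x :: 'a where S: "\<And>i. has_proj (S i)" "\<And>n. \<sigma> n \<in> {1..5}"
    "\<not> convergent (\<lambda>n. product_operator (\<lambda>n. proj (S (\<sigma> n))) (Suc n) x)"
    by (rule five_subspaces_divergent) blast
  show ?thesis
  proof (intro exI conjI)
    show "\<forall>i\<in>{1..5}. orthogonal_projection (proj (S i))"
      using orthogonal_projection_proj[OF S(1)] by blast
    show "\<forall>n\<ge>1. proj (S (\<sigma> n)) \<in> (\<lambda>i. proj (S i)) ` {1..5}" using S(2) by blast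
  qed (rule S(3))
qed

text \<open>The real construction runs in the closed real span \<open>M\<close> of the
  \<open>b n\<close>, which is orthogonal to its image under \<open>J\<close>. On \<open>M\<close>
  the complexified projections agree with the real ones, so the divergent orbit is the same.\<close>

lemma complex_divergent:
  assumes "\<not> (\<exists>B::'b::{complex_inner,complete_space} set. finite B \<and> complex_vector.span B = UNIV)"
  shows "\<exists>(x::'b) (Q::nat \<Rightarrow> 'b \<Rightarrow> 'b) (P::nat \<Rightarrow> 'b \<Rightarrow> 'b).
        (\<forall>i\<in>{1..5}. complex_orthogonal_projection (Q i)) \<and>
        (\<forall>n\<ge>1. P n \<in> Q ` {1..5}) \<and>
        \<not> convergent (\<lambda>n. product_operator P (Suc n) x)"
proof -
  \<comment> \<open>Real spans lie in complex spans, so a space without a finite complex spanning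
    set has no finite real one either.\<close>
  have span: "span B \<subseteq> complex_vector.span B" for B :: "'b set"
  proof (rule span_minimal)
    show "subspace (complex_vector.span B)"
      by (rule subspaceI)
        (auto simp: complex_vector.span_zero complex_vector.span_add complex_vector.span_scale
          simp flip: scaleC_complex_of_real)
  qed (rule complex_vector.span_superset)
  obtain b :: "nat \<Rightarrow> 'b" where b: "\<And>n. b n \<bullet> b n = 1" "\<And>m n y. m < n \<Longrightarrow> y \<in> {b m, J (b m)} \<Longrightarrow> b n \<bullet> y = 0"
  proof (rule orthonormal_sequence[of "\<lambda>x::'b. {x, J x}"])
    show "span B \<noteq> UNIV" if "finite B" for B :: "'b set" using assms span that by blast
  qed (simp, blast)
  have on: "b i \<bullet> b j = (if i = j then 1 else 0)" for i j
    using b(1)[of i] b(2)[of i j "b i"] b(2)[of j i "b j"] by (cases i j rule: linorder_cases) (auto simp: inner_commute)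
  have bJb: "J (b i) \<bullet> b j = 0" for i j
  proof (cases i j rule: linorder_cases)
    case less
    then show ?thesis using b(2)[OF less, of "J (b i)"] by (simp add: inner_commute)
  next
    case equal
    then show ?thesis using inner_J_self[of "b j"] by (simp add: inner_commute)
  next
    case greater
    then show ?thesis using b(2)[OF greater, of "J (b j)"] by (simp add: inner_J_left)
  qed
  define M where "M = closure (span (range b))"
  have "J (b i) \<bullet> z = 0" if "z \<in> M" for i z
    by (rule orthogonal_closure_span[OF _ that[unfolded M_def]]) (use bJb in auto)
  then have "J z \<bullet> b i = 0" if "z \<in> M" for i z
    using that by (simp add: inner_J_left inner_commute[of z])
  then have "J z \<bullet> x = 0" if "z \<in> M" "x \<in> M" for x z
    using that(2) unfolding M_def
    by (rule_tac orthogonal_closure_span[rotated]) (use that(1) in \<open>auto simp: M_def\<close>)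
  then have MJ: "x \<bullet> J z = 0" if "x \<in> M" "z \<in> M" for x z
    using that by (simp add: inner_commute)
  obtain S and \<sigma> :: "nat \<Rightarrow> nat" and x :: 'b where S: "\<And>i. has_proj (S i)" "\<And>i. S i \<subseteq> M" "x \<in> M"
    "\<And>n. \<sigma> n \<in> {1..5}"
    "\<not> convergent (\<lambda>n. product_operator (\<lambda>n. proj (S (\<sigma> n))) (Suc n) x)"
    unfolding M_def by (rule five_subspaces_divergent[OF on]) blast
  define T where "T i = {a + J c |a c. a \<in> S i \<and> c \<in> S i}" for i
  have SJ: "x \<bullet> J y = 0" if "x \<in> S i" "y \<in> S i" for i x y
    by (rule MJ[OF subsetD[OF S(2) that(1)] subsetD[OF S(2) that(2)]])
  have T: "has_proj (T i)" for i
    unfolding T_def by (rule proj_complexification(1)[OF S(1) SJ])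
  have JT: "J x \<in> T i" if "x \<in> T i" for i x
    using that unfolding T_def by (rule_tac proj_complexification(2)[OF S(1)]) (assumption | rule SJ)+
  have TS: "proj (T i) z = proj (S i) z" if z: "z \<in> M" for i z
    unfolding T_def
    by (rule proj_complexification(3)[OF S(1) SJ]) (auto intro: MJ[OF z] subsetD[OF S(2)])
  have "product_operator (\<lambda>n. proj (T (\<sigma> n))) n x = product_operator (\<lambda>n. proj (S (\<sigma> n))) n x
    \<and> product_operator (\<lambda>n. proj (S (\<sigma> n))) n x \<in> M" for n
  proof (induction n)
    case (Suc n)
    then show ?case using TS subsetD[OF S(2) proj_in[OF S(1)]] by simp
  qed (use S(3) in simp)
  then have eq: "product_operator (\<lambda>n. proj (T (\<sigma> n))) n x = product_operator (\<lambda>n. proj (S (\<sigma> n))) n x" for n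
    by blast
  show ?thesis
  proof (intro exI conjI)
    show "\<forall>i\<in>{1..5}. complex_orthogonal_projection (proj (T i))"
      using complex_orthogonal_projection_proj[OF T JT] by blast
    show "\<forall>n\<ge>1. proj (T (\<sigma> n)) \<in> (\<lambda>i. proj (T i)) ` {1..5}" using S(4) by blast
    show "\<not> convergent (\<lambda>n. product_operator (\<lambda>n. proj (T (\<sigma> n))) (Suc n) x)"
      unfolding eq by (rule S(5))
  qed
qed

theorem theorem0:
  shows
    "(\<not> (\<exists>B::'a::{real_inner,complete_space} set. finite B \<and> span B = UNIV) \<longrightarrow>
      (\<exists>(x::'a) (Q::nat \<Rightarrow> 'a \<Rightarrow> 'a) (P::nat \<Rightarrow> 'a \<Rightarrow> 'a).
        (\<forall>i\<in>{1..5}. orthogonal_projection (Q i)) \<and>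
        (\<forall>n\<ge>1. P n \<in> Q ` {1..5}) \<and>
        \<not> convergent (\<lambda>n. product_operator P (Suc n) x)))
     \<and>
     (\<not> (\<exists>B::'b::{complex_inner,complete_space} set. finite B \<and> complex_vector.span B = UNIV) \<longrightarrow>
      (\<exists>(x::'b) (Q::nat \<Rightarrow> 'b \<Rightarrow> 'b) (P::nat \<Rightarrow> 'b \<Rightarrow> 'b).
        (\<forall>i\<in>{1..5}. complex_orthogonal_projection (Q i)) \<and>
        (\<forall>n\<ge>1. P n \<in> Q ` {1..5}) \<and>
        \<not> convergent (\<lambda>n. product_operator P (Suc n) x)))"
  by (intro conjI impI real_divergent complex_divergent)

end
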